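(* Every finite graph $G$ (loopless, multiple edges allowed) admits a tree-cut decomposition of width equal to $\mathrm{tcw}(G)$ that is lean.
   Context: Graphs are finite, loopless, and may have multiple edges. A tree-cut decomposition of a graph $G$ is a pair $(T,\mathcal{X})$ where $T$ is a tree and $\mathcal{X}=\{X_t\subseteq V(G): t\in V(T)\}$ is a collection of pairwise disjoint (possibly empty) sets, called bags, whose union is $V(G)$. Vertices and edges of $T$ are called nodes and links. For a link $uv$ of $T$, let $T_{uv},T_{vu}$ be the components of $T-uv$ containing $u$ and $v$ respectively, and $X_{uv}=\bigcup_{t\in V(T_{uv})}X_t$, $X_{vu}=\bigcup_{t\in V(T_{vu})}X_t$. The adhesion $\mathrm{adh}(uv)$ is the set of edges of $G$ with one endpoint in $X_{uv}$ and the other in $X_{vu}$; an adhesion is bold if it has more than two edges. The width of $(T,\mathcal{X})$ is $\max\{\max_{e\in E(T)}|\mathrm{adh}(e)|,\ \max_{t\in V(T)}(|X_t|+|\{t'\in N_T(t): \mathrm{adh}(tt')\text{ is bold}\}|)\}$, and the tree-cut width $\mathrm{tcw}(G)$ is the minimum width of a tree-cut decomposition of $G$. For sets $A,B$ of edges of $G$, a path links $A$ and $B$ if its first edge is in $A$, its last edge is in $B$, and none of its internal edges lies in $A\cup B$ (a single edge in $A\cap B$ is such a path). A tree-cut decomposition $(T,\mathcal{X})$ is lean if for every $k\in\mathbb{N}$, every pair of links $a,b\in E(T)$, and every $A\subseteq \mathrm{adh}(a)$, $B\subseteq\mathrm{adh}(b)$ with $|A|=|B|=k$, either there are $k$ pairwise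 edge-disjoint paths in $G$ linking $A$ and $B$, or some link $c$ on the path of $T$ between $a$ and $b$ (the unique path of $T$ starting with $a$ and ending with $b$) satisfies $|\mathrm{adh}(c)|<k$.
   Formalization: Two parallel edges traversed one after the other also count as a path linking A and B; with vertex-distinct paths only, the claim fails for a star with at least three leaves and every edge doubled. *)

theory Defs
  imports Main "HOL-Library.Disjoint_Sets"
begin

text \<open>Undirected multigraphs with named edges: parallel edges are distinct elements of
  \<open>edges G\<close> with the same set of endpoints. Trees are multigraphs as well; their vertices
  and edges are the nodes and links.\<close>

record ('v, 'e) mgraph =
  verts :: "'v set"
  edges :: "'e set"
  ends :: "'e \<Rightarrow> 'v set"

definition fin_multigraph :: "('v, 'e) mgraph \<Rightarrow> bool" where
  "fin_multigraph G \<longleftrightarrow> finite (verts G) \<and> finite (edges G) \<and>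
     (\<forall>e\<in>edges G. ends G e \<subseteq> verts G \<and> card (ends G e) = 2)"

definition is_walk :: "('v, 'e) mgraph \<Rightarrow> 'v list \<Rightarrow> 'e list \<Rightarrow> bool" where
  "is_walk G vs es \<longleftrightarrow> length vs = Suc (length es) \<and> set vs \<subseteq> verts G \<and> set es \<subseteq> edges G \<and>
     (\<forall>i<length es. ends G (es ! i) = {vs ! i, vs ! Suc i})"

definition is_path :: "('v, 'e) mgraph \<Rightarrow> 'v list \<Rightarrow> 'e list \<Rightarrow> bool" where
  "is_path G vs es \<longleftrightarrow> is_walk G vs es \<and> distinct vs"

definition is_cycle :: "('v, 'e) mgraph \<Rightarrow> 'v list \<Rightarrow> 'e list \<Rightarrow> bool" where
  "is_cycle G vs es \<longleftrightarrow> is_walk G vs es \<and> es \<noteq> [] \<and> hd vs = last vs \<and>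
     distinct (tl vs) \<and> distinct es"

definition reachable :: "('v, 'e) mgraph \<Rightarrow> 'v \<Rightarrow> 'v \<Rightarrow> bool" where
  "reachable G u v \<longleftrightarrow> (\<exists>vs es. is_path G vs es \<and> hd vs = u \<and> last vs = v)"

definition is_tree :: "('t, 'l) mgraph \<Rightarrow> bool" where
  "is_tree T \<longleftrightarrow> fin_multigraph T \<and> verts T \<noteq> {} \<and>
     (\<forall>u\<in>verts T. \<forall>v\<in>verts T. reachable T u v) \<and> (\<nexists>vs es. is_cycle T vs es)"

definition del_edge :: "('v, 'e) mgraph \<Rightarrow> 'e \<Rightarrow> ('v, 'e) mgraph" where
  "del_edge G e = G\<lparr>edges := edges G - {e}\<rparr>"

definition tree_cut_decomp ::
    "('v, 'e) mgraph \<Rightarrow> ('t, 'l) mgraph \<Rightarrow> ('t \<Rightarrow> 'v set) \<Rightarrow> bool" where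
  "tree_cut_decomp G T X \<longleftrightarrow>
     is_tree T \<and> disjoint_family_on X (verts T) \<and> (\<Union>t\<in>verts T. X t) = verts G"

text \<open>For a link \<open>l = uv\<close>, \<open>side_bags T X l u\<close> is the set usually written \<open>X_uv\<close>.\<close>

definition side_bags :: "('t, 'l) mgraph \<Rightarrow> ('t \<Rightarrow> 'v set) \<Rightarrow> 'l \<Rightarrow> 't \<Rightarrow> 'v set" where
  "side_bags T X l u = (\<Union>t\<in>{t \<in> verts T. reachable (del_edge T l) u t}. X t)"

definition adh ::
    "('v, 'e) mgraph \<Rightarrow> ('t, 'l) mgraph \<Rightarrow> ('t \<Rightarrow> 'v set) \<Rightarrow> 'l \<Rightarrow> 'e set" where
  "adh G T X l = {e \<in> edges G. \<exists>u v x y. ends T l = {u, v} \<and> u \<noteq> v \<and>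
     x \<in> side_bags T X l u \<and> y \<in> side_bags T X l v \<and> ends G e = {x, y}}"

definition bold ::
    "('v, 'e) mgraph \<Rightarrow> ('t, 'l) mgraph \<Rightarrow> ('t \<Rightarrow> 'v set) \<Rightarrow> 'l \<Rightarrow> bool" where
  "bold G T X l \<longleftrightarrow> card (adh G T X l) > 2"

definition bold_nbrs ::
    "('v, 'e) mgraph \<Rightarrow> ('t, 'l) mgraph \<Rightarrow> ('t \<Rightarrow> 'v set) \<Rightarrow> 't \<Rightarrow> 't set" where
  "bold_nbrs G T X t =
     {t' \<in> verts T. \<exists>l\<in>edges T. ends T l = {t, t'} \<and> bold G T X l}"

text \<open>One maximum over the union of both families, so that a tree without links needs no
  separate convention.\<close>

definition decomp_width ::
    "('v, 'e) mgraph \<Rightarrow> ('t, 'l) mgraph \<Rightarrow> ('t \<Rightarrow> 'v set) \<Rightarrow> nat" where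
  "decomp_width G T X =
     Max ((\<lambda>l. card (adh G T X l)) ` edges T \<union>
          (\<lambda>t. card (X t) + card (bold_nbrs G T X t)) ` verts T)"

text \<open>Every finite tree has an isomorphic copy whose nodes and links are natural numbers, so
  restricting to such trees does not change the minimum.\<close>

definition tcw :: "('v, 'e) mgraph \<Rightarrow> nat" where
  "tcw G = (LEAST w. \<exists>(T :: (nat, nat) mgraph) X.
     tree_cut_decomp G T X \<and> decomp_width G T X = w)"

text \<open>A path linking \<open>A\<close> and \<open>B\<close>, given by its sequence of edges. A pair of parallel edges
  \<open>e, f\<close> traversed one after the other (a closed walk of length two) also counts as a path
  from \<open>e\<close> to \<open>f\<close>. No path with pairwise distinct vertices starts with \<open>e\<close> and ends with
  \<open>f\<close>, and without these closed paths lean decompositions of minimum width need not exist: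
  in a star with at least three leaves and all edges doubled, every decomposition of minimum
  width 2 has a link whose adhesion consists of two parallel edges.\<close>

definition links_sets :: "('v, 'e) mgraph \<Rightarrow> 'e set \<Rightarrow> 'e set \<Rightarrow> 'e list \<Rightarrow> bool" where
  "links_sets G A B es \<longleftrightarrow>
     (\<exists>vs. is_path G vs es \<or> is_cycle G vs es \<and> length es = 2) \<and>
     es \<noteq> [] \<and> hd es \<in> A \<and> last es \<in> B \<and> set (butlast (tl es)) \<inter> (A \<union> B) = {}"

definition edge_disjoint_linkage ::
    "('v, 'e) mgraph \<Rightarrow> 'e set \<Rightarrow> 'e set \<Rightarrow> nat \<Rightarrow> bool" where
  "edge_disjoint_linkage G A B k \<longleftrightarrow>
     (\<exists>P :: nat \<Rightarrow> 'e list. (\<forall>i<k. links_sets G A B (P i)) \<and>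
        disjoint_family_on (\<lambda>i. set (P i)) {..<k})"

definition on_link_path :: "('t, 'l) mgraph \<Rightarrow> 'l \<Rightarrow> 'l \<Rightarrow> 'l \<Rightarrow> bool" where
  "on_link_path T a b c \<longleftrightarrow>
     (\<exists>vs ls. is_path T vs ls \<and> ls \<noteq> [] \<and> hd ls = a \<and> last ls = b \<and> c \<in> set ls)"

definition lean ::
    "('v, 'e) mgraph \<Rightarrow> ('t, 'l) mgraph \<Rightarrow> ('t \<Rightarrow> 'v set) \<Rightarrow> bool" where
  "lean G T X \<longleftrightarrow>
     (\<forall>k. \<forall>a\<in>edges T. \<forall>b\<in>edges T. \<forall>A B.
        A \<subseteq> adh G T X a \<and> B \<subseteq> adh G T X b \<and> card A = k \<and> card B = k \<longrightarrow>
        edge_disjoint_linkage G A B k \<or>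
        (\<exists>c\<in>edges T. on_link_path T a b c \<and> card (adh G T X c) < k))"

end

theory Submission
  imports Defs "HOL-Library.Multiset_Order"
begin

text \<open>Among all tree-cut decompositions of minimum width take one that is minimal in the following
  sense: for \<open>j = tcw(G), ..., 0\<close> lexicographically, minimise the number of pairs of links
  all of whose separating links have adhesion at least \<open>j\<close>. Suppose links \<open>a\<close>, \<open>b\<close> and
  sets \<open>A\<close>, \<open>B\<close> of \<open>k\<close> edges violate leanness. Menger's theorem in the line graph gives a
  vertex set \<open>U\<close> whose separator, consisting of the boundary of \<open>U\<close>, the edges of \<open>A\<close> not inside
  \<open>U\<close> and the edges of \<open>B\<close> touching \<open>U\<close>, has fewer than \<open>k\<close> edges. Choose \<open>U\<close> with
  a smallest separator and, subject to that, crossing as few as possible of the sides of links that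
  contain neither \<open>a\<close> nor \<open>b\<close>. Take two copies of \<open>T\<close>, one with bags \<open>X_t \<inter> U\<close> and \<open>b\<close>
  subdivided, one with bags \<open>X_t - U\<close> and \<open>a\<close> subdivided, and join the two subdividing
  nodes. Submodularity shows that neither the adhesions nor the width grow, and that as soon as
  one of the links arising from a link \<open>e\<close> keeps the adhesion of \<open>e\<close>, all others have
  adhesion less than \<open>k\<close>. As the new link has adhesion less than \<open>k\<close> and separates what is
  left of \<open>a\<close> from what is left of \<open>b\<close>, the new decomposition is smaller, a contradiction.

  Paths in trees are avoided by means of edge cuts: a multigraph is a tree iff only trivial vertex
  sets have an empty cut and every link is the only element of some cut.\<close>


section \<open>Menger's theorem for digraphs\<close>

text \<open>The obstacle is doubling: every link of \<open>T\<close> leaves a descendant in each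
  copy, so the number of links of large adhesion could grow. The choice of \<open>U\<close> prevents
  this. If a side \<open>W\<close> does not contain the whole link \<open>b\<close>, no edge of
  \<open>B\<close> lies inside \<open>XX W\<close>, and this makes the uncrossing inequality for
  \<open>U\<close> and \<open>XX W\<close> true. As \<open>U \<union> XX W\<close> is not a smaller
  separator, \<open>d (XX W \<inter> U) \<le> d (XX W)\<close> follows. Hence the copy that carries
  \<open>U\<close> is split at \<open>b\<close>: all its links are named by such sides, the halves
  of \<open>b\<close> by the two sides of \<open>b\<close>. The other copy is the same situation
  with \<open>a\<close>, \<open>b\<close> exchanged and \<open>U\<close> complemented. Links of
  adhesion below \<open>k\<close> may multiply freely: the counts are only compared from some level
  that is at least \<open>k\<close> upwards, and they drop strictly at that level. Counting pairs
  rather than links matters when every link of large adhesion survives in exactly one copy; then the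
  only visible progress is that \<open>a\<close> and \<open>b\<close> have lost contact.\<close>

definition joins :: "('a \<times> 'a) set \<Rightarrow> 'a set \<Rightarrow> 'a set \<Rightarrow> 'a set \<Rightarrow> bool" where
  "joins R C A B \<longleftrightarrow> (\<exists>a\<in>A \<inter> C. \<exists>b\<in>B \<inter> C. (a, b) \<in> (Restr R C)\<^sup>*)"

text \<open>Like \<open>joins\<close>, this avoids vertex sequences. A linkage is a family of vertex
  sets each carrying a connection, so disjointness is plain disjointness of sets and gluing is
  union; genuine paths are extracted only in \<open>joins_line_rel_linksE\<close>.\<close>

definition separates :: "('a \<times> 'a) set \<Rightarrow> 'a set \<Rightarrow> 'a set \<Rightarrow> 'a set \<Rightarrow> bool" where
  "separates R S A B \<longleftrightarrow> (\<forall>a\<in>A - S. \<forall>b\<in>B - S. (a, b) \<notin> (Restr R (- S))\<^sup>*)"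

lemma Restr_mono: "R \<subseteq> R' \<Longrightarrow> C \<subseteq> C' \<Longrightarrow> Restr R C \<subseteq> Restr R' C'"
  by blast

lemma rtrancl_Restr_mono:
  "(a, b) \<in> (Restr R C)\<^sup>* \<Longrightarrow> R \<subseteq> R' \<Longrightarrow> C \<subseteq> C' \<Longrightarrow> (a, b) \<in> (Restr R' C')\<^sup>*"
  using rtrancl_mono[OF Restr_mono] by blast

lemma joins_mono: "joins R C A B \<Longrightarrow> R \<subseteq> R' \<Longrightarrow> joins R' C A B"
  unfolding joins_def using rtrancl_Restr_mono[of _ _ R C R' C] by blast

lemma Restr_converse: "Restr (R\<inverse>) C = (Restr R C)\<inverse>"
  by blast

lemma joins_converse: "joins (R\<inverse>) C B A \<longleftrightarrow> joins R C A B"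
  unfolding joins_def Restr_converse rtrancl_converse by blast

lemma separates_converse: "separates (R\<inverse>) S B A \<longleftrightarrow> separates R S A B"
  unfolding separates_def Restr_converse rtrancl_converse by blast

text \<open>The connection is stopped at its first vertex in \<open>P\<close>. What remains is
  reachable from \<open>A\<close> without touching \<open>S\<close>, except possibly
  \<open>p\<close> itself; this later confines the meetings of pieces from the two ends to
  \<open>S\<close>.\<close>

lemma joins_trim:
  assumes "joins R C A P" and CP: "C \<inter> P \<subseteq> {p}" and "S \<subseteq> P"
  shows "\<exists>C'\<subseteq>C. joins R C' A {p} \<and> (\<forall>v\<in>C' - S. \<exists>a\<in>A - S. (a, v) \<in> (Restr R (- S))\<^sup>*)"
proof -
  obtain a b where a: "a \<in> A" "a \<in> C" and b: "b \<in> P" "b \<in> C" and ab: "(a, b) \<in> (Restr R C)\<^sup>*"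
    using assms(1) unfolding joins_def by blast
  have bp: "b = p" and pC: "p \<in> C" "p \<in> P" using CP b by auto
  \<comment> \<open>The vertices reached before \<open>P\<close> is entered, and the entry point. If
    \<open>a\<close> lies in \<open>P\<close>, then \<open>a = p\<close> and only \<open>{p}\<close>
    is kept.\<close>
  define C' where "C' = insert p {v \<in> C - P. (a, v) \<in> (Restr R (C - P))\<^sup>* \<and> a \<notin> P}"
  have C'C: "C' \<subseteq> C" using pC by (auto simp: C'_def)
  have aC': "a \<in> C'" using a CP by (auto simp: C'_def)
  have main: "(a, p) \<in> (Restr R C')\<^sup>* \<or> (a \<notin> P \<and> v \<notin> P \<and> (a, v) \<in> (Restr R (C - P))\<^sup>* \<and> (a, v) \<in> (Restr R C')\<^sup>*)"
    if "(a, v) \<in> (Restr R C)\<^sup>*" for v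
    using that
  proof (induction rule: rtrancl_induct)
    case base
    then show ?case using a CP by auto
  next
    case (step v w)
    show ?case
    proof (cases "(a, p) \<in> (Restr R C')\<^sup>*")
      case False
      then have v: "a \<notin> P" "v \<notin> P" "(a, v) \<in> (Restr R (C - P))\<^sup>*" "(a, v) \<in> (Restr R C')\<^sup>*"
        using step.IH by auto
      have vw: "(v, w) \<in> R" "v \<in> C" "w \<in> C" using step.hyps by auto
      have vC': "v \<in> C'" using v vw by (simp add: C'_def)
      show ?thesis
      proof (cases "w \<in> P")
        case True
        then have "w = p" using vw CP by auto
        then have "(v, p) \<in> Restr R C'"
          using vw vC' by (auto simp: C'_def[symmetric]) (simp add: C'_def)
        then show ?thesis using v(4) by (meson rtrancl.rtrancl_into_rtrancl)
      next
        case False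
        have 1: "(a, w) \<in> (Restr R (C - P))\<^sup>*"
          using v(2,3) vw False by (intro rtrancl.rtrancl_into_rtrancl[OF v(3)]) auto
        then have "w \<in> C'" using vw False v by (simp add: C'_def)
        then have "(a, w) \<in> (Restr R C')\<^sup>*"
          using vC' vw by (intro rtrancl.rtrancl_into_rtrancl[OF v(4)]) auto
        then show ?thesis using 1 v False by blast
      qed
    qed simp
  qed
  have "(a, p) \<in> (Restr R C')\<^sup>*" using main[OF ab] bp b by auto
  then have j: "joins R C' A {p}" unfolding joins_def using a aC' by (auto simp: C'_def)
  have "\<exists>a\<in>A - S. (a, v) \<in> (Restr R (- S))\<^sup>*" if v: "v \<in> C' - S" for v
  proof (cases "v = p")
    case True
    then have "C \<inter> S = {}" using CP v \<open>S \<subseteq> P\<close> by auto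
    then have "C \<subseteq> - S" by auto
    then have "(a, v) \<in> (Restr R (- S))\<^sup>*"
      using rtrancl_Restr_mono[OF ab order.refl] bp True by simp
    then show ?thesis using a \<open>C \<subseteq> - S\<close> by blast
  next
    case False
    then have "(a, v) \<in> (Restr R (C - P))\<^sup>*" "a \<notin> P" using v by (auto simp: C'_def)
    moreover have "C - P \<subseteq> - S" using \<open>S \<subseteq> P\<close> by auto
    ultimately have "(a, v) \<in> (Restr R (- S))\<^sup>*" "a \<notin> S"
      using rtrancl_Restr_mono[of a v R "C - P" R "- S"] \<open>S \<subseteq> P\<close> by auto
    then show ?thesis using a by blast
  qed
  then show ?thesis using C'C j by blast
qed

lemma joins_trans:
  assumes "joins R C A {p}" "joins R D {q} B" "p = q \<or> (p, q) \<in> R"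
  shows "joins R (C \<union> D) A B"
proof -
  obtain a where a: "a \<in> A \<inter> C" "p \<in> C" "(a, p) \<in> (Restr R C)\<^sup>*"
    using assms(1) by (auto simp: joins_def)
  obtain b where b: "b \<in> B \<inter> D" "q \<in> D" "(q, b) \<in> (Restr R D)\<^sup>*"
    using assms(2) by (auto simp: joins_def)
  have "(a, p) \<in> (Restr R (C \<union> D))\<^sup>*" using a(3) by (rule rtrancl_Restr_mono) auto
  moreover have "(p, q) \<in> (Restr R (C \<union> D))\<^sup>*" using assms(3) a b by auto
  moreover have "(q, b) \<in> (Restr R (C \<union> D))\<^sup>*" using b(3) by (rule rtrancl_Restr_mono) auto
  ultimately have "(a, b) \<in> (Restr R (C \<union> D))\<^sup>*" by (meson rtrancl_trans)
  then show ?thesis using a b by (auto simp: joins_def)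
qed

text \<open>If deleting the arc \<open>(x, y)\<close> creates a separator \<open>S\<close> that is too small, then every
  separator of \<open>A\<close> from \<open>S \<union> {x}\<close> in the smaller digraph still separates \<open>A\<close> from \<open>B\<close>.\<close>

lemma separates_insert:
  assumes "separates (R - {(x, y)}) S A B" and "z = x \<or> z = y"
  shows "separates R (insert z S) A B"
proof -
  have "Restr R (- insert z S) \<subseteq> Restr (R - {(x, y)}) (- S)" using assms(2) by auto
  then have "(Restr R (- insert z S))\<^sup>* \<subseteq> (Restr (R - {(x, y)}) (- S))\<^sup>*" by (rule rtrancl_mono)
  then show ?thesis using assms(1) unfolding separates_def by blast
qed

lemma separates_from_insert:
  assumes S: "separates (R - {(x, y)}) S A B"
    and Z: "separates (R - {(x, y)}) Z A (insert x S)"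
  shows "separates R Z A B"
  unfolding separates_def
proof (intro ballI notI)
  fix a b assume a: "a \<in> A - Z" and b: "b \<in> B - Z" and ab: "(a, b) \<in> (Restr R (- Z))\<^sup>*"
  let ?R = "R - {(x, y)}" and ?P = "insert x S"
  have no: "(a, p) \<notin> (Restr ?R (- Z))\<^sup>*" if "p \<in> ?P - Z" for p
    using Z a that unfolding separates_def by blast
  have aP: "a \<notin> ?P" using no a by blast
  \<comment> \<open>Before its first vertex in \<open>?P\<close> a walk cannot have used the arc
    \<open>(x, y)\<close>, which starts in \<open>?P\<close>. So it runs in \<open>?R\<close>, where
    \<open>Z\<close> keeps it from reaching \<open>?P\<close> at all.\<close>
  have "v \<notin> ?P \<and> v \<notin> Z \<and> (a, v) \<in> (Restr ?R (- Z - ?P))\<^sup>*" if "(a, v) \<in> (Restr R (- Z))\<^sup>*" for v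
    using that
  proof (induction rule: rtrancl_induct)
    case base
    then show ?case using aP a by auto
  next
    case (step v w)
    have 1: "(v, w) \<in> ?R" "w \<notin> Z" using step by auto
    have "(a, v) \<in> (Restr ?R (- Z))\<^sup>*"
      using step.IH rtrancl_Restr_mono[of a v ?R "- Z - ?P" ?R "- Z"] by blast
    moreover have "(v, w) \<in> Restr ?R (- Z)" using 1 step.IH by simp
    ultimately have "(a, w) \<in> (Restr ?R (- Z))\<^sup>*" by (rule rtrancl.rtrancl_into_rtrancl)
    then have "w \<notin> ?P" using no 1 by blast
    then have "(v, w) \<in> Restr ?R (- Z - ?P)" using step.IH 1 by simp
    then have "(a, w) \<in> (Restr ?R (- Z - ?P))\<^sup>*"
      using step.IH by (meson rtrancl.rtrancl_into_rtrancl)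
    then show ?case using \<open>w \<notin> ?P\<close> 1 by blast
  qed
  note b_reached = this[OF ab]
  then have "(a, b) \<in> (Restr ?R (- S))\<^sup>*"
    by (intro rtrancl_Restr_mono[of a b ?R "- Z - ?P" ?R "- S"]) auto
  moreover have "b \<notin> S" using b_reached by blast
  ultimately
  show False using S aP a b unfolding separates_def by blast
qed

text \<open>Pigeonhole: \<open>k\<close> disjoint sets that all meet a set of \<open>k\<close>
  elements meet it in one element each, so these elements can serve as indices.\<close>

lemma disjoint_joins_reindex:
  assumes "\<forall>i<k. joins R (C i) A P" and "disjoint_family_on C {..<k::nat}"
    and "finite P" and "card P = k"
  shows "\<exists>D. \<forall>p\<in>P. joins R (D p) A P \<and> D p \<inter> P = {p} \<and> (\<forall>q\<in>P. q \<noteq> p \<longrightarrow> D p \<inter> D q = {})"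
proof -
  have "\<forall>i<k. \<exists>p. p \<in> P \<inter> C i" using assms(1) by (auto simp: joins_def)
  then obtain h where h: "\<And>i. i < k \<Longrightarrow> h i \<in> P \<inter> C i" by metis
  have disj: "C i \<inter> C j = {}" if "i < k" "j < k" "i \<noteq> j" for i j
    using assms(2) that by (auto simp: disjoint_family_on_def)
  have inj: "inj_on h {..<k}"
  proof (rule inj_onI)
    fix i j assume ij: "i \<in> {..<k}" "j \<in> {..<k}" "h i = h j"
    show "i = j"
    proof (rule ccontr)
      assume "i \<noteq> j"
      then show False using disj[of i j] h[of i] h[of j] ij by auto
    qed
  qed
  have "h ` {..<k} \<subseteq> P" using h by auto
  then have img: "h ` {..<k} = P"
    using card_image[OF inj] assms(3,4) by (intro card_subset_eq) auto
  define g where "g = inv_into {..<k} h"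
  have g: "g p < k" "h (g p) = p" if "p \<in> P" for p
    using that img f_inv_into_f[of p h "{..<k}"] inv_into_into[of p h "{..<k}"]
      by (auto simp: g_def)
  have g2: "g p \<noteq> g q" if "p \<in> P" "q \<in> P" "p \<noteq> q" for p q
    using g that by metis
  have pC: "p \<in> C (g p)" if "p \<in> P" for p using h g that by force
  have "C (g p) \<inter> P = {p}" if "p \<in> P" for p
    using pC g g2 disj that by blast
  then show ?thesis using assms(1) g g2 disj by (intro exI[of _ "\<lambda>p. C (g p)"]) auto
qed

text \<open>Induction on the set of arcs. If deleting \<open>(x, y)\<close> creates a separator
  \<open>S\<close> with fewer than \<open>k\<close> vertices, then \<open>S\<close> with
  \<open>x\<close> and \<open>S\<close> with \<open>y\<close> both have exactly \<open>k\<close>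
  vertices. The induction hypothesis links \<open>A\<close> to the former and the latter to
  \<open>B\<close>, and the two linkages are glued along \<open>S\<close> and the deleted
  arc.\<close>

theorem menger:
  fixes R :: "('a \<times> 'a) set"
  assumes "finite R" and "finite A" and "finite B"
    and "\<And>S. finite S \<Longrightarrow> separates R S A B \<Longrightarrow> k \<le> card S"
  shows "\<exists>C :: nat \<Rightarrow> 'a set. (\<forall>i<k. joins R (C i) A B) \<and> disjoint_family_on C {..<k}"
  using assms
proof (induction R arbitrary: A B rule: finite_psubset_induct)
  case (psubset R)
  show ?case
  proof (cases "R = {}")
    case True
    have "separates R (A \<inter> B) A B" using True by (auto simp: separates_def)
    then have "k \<le> card (A \<inter> B)" using psubset.prems by blast
    then obtain I where I: "I \<subseteq> A \<inter> B" "card I = k" "finite I"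
      using obtain_subset_with_card_n psubset.prems(1) by (metis finite_Int finite_subset)
    obtain h where h: "bij_betw h {0..<k} I" using ex_bij_betw_nat_finite[OF I(3)] I(2) by auto
    have "\<forall>i<k. joins R {h i} A B"
    proof (intro allI impI)
      fix i assume "i < k"
      then have "h i \<in> A \<inter> B" using h I(1) bij_betwE by fastforce
      then show "joins R {h i} A B" by (auto simp: joins_def)
    qed
    moreover have "disjoint_family_on (\<lambda>i. {h i}) {..<k}"
      using h by (auto simp: disjoint_family_on_def bij_betw_def inj_on_def)
    ultimately show ?thesis by (intro exI[of _ "\<lambda>i. {h i}"]) simp
  next
    case False
    then obtain x y where xy: "(x, y) \<in> R" by auto
    let ?R = "R - {(x, y)}"
    have R0: "?R \<subset> R" using xy by auto
    show ?thesis
    proof (cases "\<forall>S. finite S \<longrightarrow> separates ?R S A B \<longrightarrow> k \<le> card S")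
      case True
      from psubset.IH[OF R0 psubset.prems(1,2)] True
      obtain C where "\<forall>i<k. joins ?R (C i) A B" "disjoint_family_on C {..<k}" by blast
      then show ?thesis using joins_mono[of ?R _ A B R] by (intro exI[of _ C]) simp
    next
      case False
      then obtain S where S: "finite S" "separates ?R S A B" "card S < k" by auto
      let ?P = "insert x S" and ?Q = "insert y S"
      have "k \<le> card ?P" "k \<le> card ?Q"
        using psubset.prems(3) separates_insert[OF S(2)] S(1) by auto
      then have xS: "x \<notin> S" "card ?P = k" and yS: "y \<notin> S" "card ?Q = k"
        using S by (auto simp: card_insert_if split: if_splits)
      have "\<And>Z. finite Z \<Longrightarrow> separates ?R Z A ?P \<Longrightarrow> k \<le> card Z"
        using separates_from_insert[OF S(2)] psubset.prems(3) by blast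
      from psubset.IH[OF R0 psubset.prems(1) _ this] S(1)
      obtain C where "\<forall>i<k. joins ?R (C i) A ?P" "disjoint_family_on C {..<k}" by blast
      from disjoint_joins_reindex[OF this _ xS(2)] S(1)
      obtain C where C: "\<And>p. p \<in> ?P \<Longrightarrow> joins ?R (C p) A ?P"
        "\<And>p. p \<in> ?P \<Longrightarrow> C p \<inter> ?P = {p}"
        "\<And>p q. p \<in> ?P \<Longrightarrow> q \<in> ?P \<Longrightarrow> q \<noteq> p \<Longrightarrow> C p \<inter> C q = {}" by (metis finite_insert)
      \<comment> \<open>Reversing all arcs reduces the half towards \<open>B\<close> to the results
        already available for the half starting in \<open>A\<close>.\<close>
      have conv: "?R\<inverse> = R\<inverse> - {(y, x)}" by auto
      have "k \<le> card Z" if "finite Z" and Z: "separates ?R Z ?Q B" for Z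
      proof -
        have "separates (R\<inverse> - {(y, x)}) S B A" "separates (R\<inverse> - {(y, x)}) Z B ?Q"
          using S(2) Z unfolding conv[symmetric] separates_converse by auto
        then have "separates (R\<inverse>) Z B A" by (rule separates_from_insert)
        then have "separates R Z A B" unfolding separates_converse .
        then show ?thesis using psubset.prems(3) that by blast
      qed
      then have "\<exists>D. (\<forall>i<k. joins ?R (D i) ?Q B) \<and> disjoint_family_on D {..<k}"
        using S(1) by (intro psubset.IH[OF R0 _ psubset.prems(2)]) auto
      then obtain D where "\<forall>i<k. joins ?R (D i) ?Q B" "disjoint_family_on D {..<k}" by blast
      then have "\<forall>i<k. joins (?R\<inverse>) (D i) B ?Q" "disjoint_family_on D {..<k}"
        unfolding joins_converse by auto
      from disjoint_joins_reindex[OF this _ yS(2)] S(1)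
      obtain D where D: "\<And>p. p \<in> ?Q \<Longrightarrow> joins (?R\<inverse>) (D p) B ?Q"
        "\<And>p. p \<in> ?Q \<Longrightarrow> D p \<inter> ?Q = {p}"
        "\<And>p q. p \<in> ?Q \<Longrightarrow> q \<in> ?Q \<Longrightarrow> q \<noteq> p \<Longrightarrow> D p \<inter> D q = {}" by (metis finite_insert)
      have "\<exists>C'\<subseteq>C p. joins ?R C' A {p} \<and> (\<forall>v\<in>C' - S. \<exists>a\<in>A - S. (a, v) \<in> (Restr ?R (- S))\<^sup>*)"
        if "p \<in> ?P" for p
        using C(2)[OF that] by (intro joins_trim[OF C(1)[OF that]]) auto
      then obtain C' where C': "\<And>p. p \<in> ?P \<Longrightarrow> C' p \<subseteq> C p" "\<And>p. p \<in> ?P \<Longrightarrow> joins ?R (C' p) A {p}"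
        "\<And>p v. p \<in> ?P \<Longrightarrow> v \<in> C' p - S \<Longrightarrow> \<exists>a\<in>A - S. (a, v) \<in> (Restr ?R (- S))\<^sup>*"
        by metis
      have "\<exists>D'\<subseteq>D p. joins (?R\<inverse>) D' B {p} \<and> (\<forall>v\<in>D' - S. \<exists>b\<in>B - S. (b, v) \<in> (Restr (?R\<inverse>) (- S))\<^sup>*)"
        if "p \<in> ?Q" for p
        using D(2)[OF that] by (intro joins_trim[OF D(1)[OF that]]) auto
      then obtain D' where D': "\<And>p. p \<in> ?Q \<Longrightarrow> D' p \<subseteq> D p" "\<And>p. p \<in> ?Q \<Longrightarrow> joins (?R\<inverse>) (D' p) B {p}"
        "\<And>p v. p \<in> ?Q \<Longrightarrow> v \<in> D' p - S \<Longrightarrow> \<exists>b\<in>B - S. (b, v) \<in> (Restr (?R\<inverse>) (- S))\<^sup>*"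
        by metis
      \<comment> \<open>A common vertex outside \<open>S\<close> would connect \<open>A\<close> to
        \<open>B\<close> around \<open>S\<close>; a common vertex in \<open>S\<close> is the
        terminal vertex of both pieces.\<close>
      have meet: "p = q" if p: "p \<in> ?P" and q: "q \<in> ?Q" and v: "v \<in> C' p" "v \<in> D' q" for p q v
      proof -
        have "v \<in> S"
        proof (rule ccontr)
          assume "v \<notin> S"
          then obtain a b where "a \<in> A - S" "(a, v) \<in> (Restr ?R (- S))\<^sup>*"
            and "b \<in> B - S" "(b, v) \<in> (Restr (?R\<inverse>) (- S))\<^sup>*"
            using C'(3)[OF p] D'(3)[OF q] v by blast
          moreover then have "(v, b) \<in> (Restr ?R (- S))\<^sup>*"
            unfolding Restr_converse rtrancl_converse by blast
          ultimately show False using S(2) unfolding separates_def by (meson rtrancl_trans)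
        qed
        then have "v = p" "v = q" using C(2)[OF p] D(2)[OF q] C'(1)[OF p] D'(1)[OF q] v by blast+
        then show ?thesis by simp
      qed
      \<comment> \<open>The gluing bijection between the two terminal sets: identity on
        \<open>S\<close>, and \<open>x\<close> goes to \<open>y\<close> through the deleted
        arc.\<close>
      define \<phi> where "\<phi> p = (if p = x then y else p)" for p
      have \<phi>: "\<phi> p \<in> ?Q" if "p \<in> ?P" for p using that by (auto simp: \<phi>_def)
      have \<phi>_inj: "\<phi> p \<noteq> \<phi> q" if "p \<in> ?P" "q \<in> ?P" "p \<noteq> q" for p q
        using that yS by (auto simp: \<phi>_def)
      define F where "F p = C' p \<union> D' (\<phi> p)" for p
      have F: "joins R (F p) A B" if "p \<in> ?P" for p
        unfolding F_def
      proof (rule joins_trans)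
        show "joins R (C' p) A {p}" using C'(2)[OF that] joins_mono by blast
        show "joins R (D' (\<phi> p)) {\<phi> p} B"
          using D'(2)[OF \<phi>[OF that]] joins_mono[of ?R] joins_converse by blast
        show "p = \<phi> p \<or> (p, \<phi> p) \<in> R" using xy by (auto simp: \<phi>_def)
      qed
      have meet': "C' p \<inter> D' (\<phi> q) = {}" if "p \<in> ?P" "q \<in> ?P" "p \<noteq> q" for p q
      proof (rule ccontr)
        assume "C' p \<inter> D' (\<phi> q) \<noteq> {}"
        then obtain v where v: "v \<in> C' p" "v \<in> D' (\<phi> q)" by blast
        have eq: "p = \<phi> q" using meet[OF that(1) \<phi>[OF that(2)] v] .
        then have "q = x" using that by (auto simp: \<phi>_def split: if_splits)
        then have "p = y" using eq by (simp add: \<phi>_def)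
        then show False using that yS \<open>q = x\<close> by auto
      qed
      have disjF: "F p \<inter> F q = {}" if "p \<in> ?P" "q \<in> ?P" "p \<noteq> q" for p q
      proof -
        have "C' p \<inter> C' q = {}" using C(3) C'(1) that by blast
        moreover have "D' (\<phi> p) \<inter> D' (\<phi> q) = {}"
          using D(3)[OF \<phi> \<phi>] \<phi>_inj D'(1) \<phi> that by (metis Int_mono subset_empty)
        ultimately show ?thesis using meet'[of p q] meet'[of q p] that unfolding F_def by blast
      qed
      obtain h where h: "bij_betw h {0..<k} ?P"
        using ex_bij_betw_nat_finite[of ?P] S(1) xS(2) by auto
      have "\<forall>i<k. joins R (F (h i)) A B" using F h bij_betwE by fastforce
      moreover have "disjoint_family_on (\<lambda>i. F (h i)) {..<k}"
        unfolding disjoint_family_on_def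
      proof (intro ballI impI)
        fix i j assume "i \<in> {..<k}" "j \<in> {..<k}" and ij: "i \<noteq> j"
        then have k: "i \<in> {0..<k}" "j \<in> {0..<k}" by auto
        then have "h i \<in> ?P" "h j \<in> ?P" using h bij_betwE by blast+
        moreover have "h i \<noteq> h j" using inj_onD[OF bij_betw_imp_inj_on[OF h] _ k] ij by blast
        ultimately
        show "F (h i) \<inter> F (h j) = {}" using disjF by blast
      qed
      ultimately show ?thesis by (intro exI[of _ "\<lambda>i. F (h i)"]) simp
    qed
  qed
qed


section \<open>Linkages and separators in the line graph\<close>

definition edge_cut :: "('v, 'e) mgraph \<Rightarrow> 'v set \<Rightarrow> 'e set" where
  "edge_cut G W = {e \<in> edges G. ends G e \<inter> W \<noteq> {} \<and> \<not> ends G e \<subseteq> W}"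

text \<open>Adjacency of the line graph, with a loop at every edge. Vertex-disjoint sets here are
  edge-disjoint in \<open>G\<close>, so the vertex version of Menger's theorem applies.\<close>

definition line_rel :: "('v, 'e) mgraph \<Rightarrow> ('e \<times> 'e) set" where
  "line_rel G = {(e, f). e \<in> edges G \<and> f \<in> edges G \<and> ends G e \<inter> ends G f \<noteq> {}}"

text \<open>The edges of a separator of \<open>A\<close> from \<open>B\<close> in the line graph, where \<open>U\<close> is
  the set of vertices on the side of \<open>A\<close>.\<close>

definition sepset :: "('v, 'e) mgraph \<Rightarrow> 'e set \<Rightarrow> 'e set \<Rightarrow> 'v set \<Rightarrow> 'e set" where
  "sepset G A B U = {e \<in> edges G. e \<in> A \<and> \<not> ends G e \<subseteq> U \<or> e \<in> B \<and> ends G e \<inter> U \<noteq> {} \<or> e \<in> edge_cut G U}"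

lemma fin_multigraph_ends:
  assumes "fin_multigraph G" "e \<in> edges G"
  shows "ends G e \<subseteq> verts G" "card (ends G e) = 2" "finite (ends G e)"
  using assms unfolding fin_multigraph_def by (auto intro: card_ge_0_finite)

lemma fin_multigraph_endsE:
  assumes "fin_multigraph G" "e \<in> edges G"
  obtains x y where "ends G e = {x, y}" "x \<noteq> y" "x \<in> verts G" "y \<in> verts G"
  using fin_multigraph_ends[OF assms] by (auto simp: card_2_iff)

lemma ends_eq_insert:
  assumes "fin_multigraph G" "e \<in> edges G" "x \<in> ends G e" "y \<in> ends G e" "x \<noteq> y"
  shows "ends G e = {x, y}"
proof -
  obtain u v where "ends G e = {u, v}" by (rule fin_multigraph_endsE[OF assms(1,2)])
  then show ?thesis using assms(3-5) by auto
qed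

lemma rtrancl_Restr_list:
  assumes "(a, b) \<in> (Restr R C)\<^sup>*" "a \<in> C"
  shows "\<exists>es. es \<noteq> [] \<and> hd es = a \<and> last es = b \<and> set es \<subseteq> C \<and>
    (\<forall>i. Suc i < length es \<longrightarrow> (es ! i, es ! Suc i) \<in> R)"
  using assms
proof (induction rule: rtrancl_induct)
  case base
  then show ?case by (intro exI[of _ "[a]"]) auto
next
  case (step y z)
  then obtain es where es: "es \<noteq> []" "hd es = a" "last es = y" "set es \<subseteq> C"
    "\<And>i. Suc i < length es \<Longrightarrow> (es ! i, es ! Suc i) \<in> R" by auto
  have "((es @ [z]) ! i, (es @ [z]) ! Suc i) \<in> R" if "Suc i < length (es @ [z])" for i
  proof (cases "Suc i < length es")
    case True
    then show ?thesis using es(5)[OF True] by (simp add: nth_append)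
  next
    case False
    then have "i = length es - 1" "Suc i = length es" using that by auto
    then show ?thesis using es(1,3) step.hyps(2) by (simp add: nth_append last_conv_nth)
  qed
  then show ?case using es step.hyps(2) by (intro exI[of _ "es @ [z]"]) auto
qed

text \<open>A shortest walk in the line graph is the edge sequence of a path of \<open>G\<close>, except that it
  may consist of two parallel edges.\<close>

lemma joins_line_rel_linksE:
  assumes G: "fin_multigraph G" and A: "A \<subseteq> edges G" and B: "B \<subseteq> edges G"
    and j: "joins (line_rel G) C A B"
  obtains es where "links_sets G A B es" "set es \<subseteq> C"
proof -
  define ok where "ok es \<longleftrightarrow> es \<noteq> [] \<and> hd es \<in> A \<and> last es \<in> B \<and> set es \<subseteq> C \<and>
    (\<forall>i. Suc i < length es \<longrightarrow> (es ! i, es ! Suc i) \<in> line_rel G)" for es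
  obtain a b where ab: "a \<in> A \<inter> C" "b \<in> B \<inter> C" "(a, b) \<in> (Restr (line_rel G) C)\<^sup>*"
    using j by (auto simp: joins_def)
  then have "\<exists>es. ok es" using rtrancl_Restr_list[OF ab(3)] unfolding ok_def by auto
  then obtain es where es: "ok es" and min: "\<And>es'. ok es' \<Longrightarrow> length es \<le> length es'"
    using ex_has_least_nat[of ok _ length] by metis
  define n where "n = length es"
  have n0: "0 < n" and hdA: "es ! 0 \<in> A" and lastB: "es ! (n - 1) \<in> B" and setC: "set es \<subseteq> C"
    and adj: "\<And>i. Suc i < n \<Longrightarrow> (es ! i, es ! Suc i) \<in> line_rel G"
    using es by (auto simp: ok_def n_def hd_conv_nth last_conv_nth)
  have okI: "ok es'" if "es' \<noteq> []" "es' ! 0 \<in> A" "es' ! (length es' - 1) \<in> B" "set es' \<subseteq> C"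
     "\<And>i. Suc i < length es' \<Longrightarrow> (es' ! i, es' ! Suc i) \<in> line_rel G" for es'
    using that by (auto simp: ok_def hd_conv_nth last_conv_nth)
  have E: "es ! i \<in> edges G" if "i < n" for i
  proof (cases i)
    case 0
    then show ?thesis using hdA A by auto
  next
    case (Suc m)
    then show ?thesis using adj[of m] that by (auto simp: line_rel_def)
  qed
  have noB: "es ! i \<notin> B" if "Suc i < n" for i
  proof
    assume "es ! i \<in> B"
    moreover have "set (take (Suc i) es) \<subseteq> C" using setC set_take_subset[of "Suc i" es] by blast
    ultimately have "ok (take (Suc i) es)"
      using that hdA n0 adj by (intro okI) (auto simp: n_def)
    then show False using min[of "take (Suc i) es"] that by (auto simp: n_def)
  qed
  have noA: "es ! i \<notin> A" if "0 < i" "i < n" for i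
  proof
    assume "es ! i \<in> A"
    moreover have "set (drop i es) \<subseteq> C" using setC set_drop_subset[of i es] by blast
    ultimately have "ok (drop i es)"
      using that lastB n0 adj by (intro okI) (auto simp: n_def)
    then show False using min[of "drop i es"] that by (auto simp: n_def)
  qed
  have far: "ends G (es ! i) \<inter> ends G (es ! j) = {}" if "Suc i < j" "j < n" for i j
  proof (rule ccontr)
    assume ne: "ends G (es ! i) \<inter> ends G (es ! j) \<noteq> {}"
    let ?es = "take (Suc i) es @ drop j es"
    have len: "length ?es = Suc i + (n - j)" using that by (simp add: n_def)
    have nth1: "?es ! m = es ! m" if "m \<le> i" for m
      using that \<open>Suc i < j\<close> \<open>j < n\<close> by (simp add: nth_append n_def)
    have nth2: "?es ! m = es ! (j + (m - Suc i))" if "m > i" for m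
      using that \<open>Suc i < j\<close> \<open>j < n\<close> by (simp add: nth_append n_def)
    have "ok ?es"
    proof (rule okI)
      show "?es \<noteq> []" using that by (simp add: n_def)
      show "?es ! 0 \<in> A" using nth1[of 0] hdA by simp
      have "length ?es - 1 > i" "j + (length ?es - 1 - Suc i) = n - 1" using len that by auto
      then show "?es ! (length ?es - 1) \<in> B" using nth2[of "length ?es - 1"] lastB by metis
      show "set ?es \<subseteq> C" using setC set_take_subset[of "Suc i" es] set_drop_subset[of j es] by auto
      fix m assume m: "Suc m < length ?es"
      consider "Suc m \<le> i" | "m = i" | "m > i" by linarith
      then show "(?es ! m, ?es ! Suc m) \<in> line_rel G"
      proof cases
        case 1
        then show ?thesis using nth1[of m] nth1[of "Suc m"] adj[of m] that by simp
      next
        case 2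
        then have "?es ! m = es ! i" "?es ! Suc m = es ! j"
          using nth1[of m] nth2[of "Suc m"] by simp_all
        then show ?thesis using ne E[of i] E[of j] that by (simp add: line_rel_def)
      next
        case 3
        then have "j + (Suc m - Suc i) = Suc (j + (m - Suc i))" by simp
        moreover have "?es ! Suc m = es ! (j + (Suc m - Suc i))" using 3 by (intro nth2) simp
        ultimately have "?es ! Suc m = es ! Suc (j + (m - Suc i))" by (simp only:)
        moreover have "Suc (j + (m - Suc i)) < n" using m len 3 by linarith
        ultimately show ?thesis using nth2[OF 3] adj[of "j + (m - Suc i)"] by metis
      qed
    qed
    then show False using min[of ?es] len that by (simp add: n_def)
  qed
  have inner: "set (butlast (tl es)) \<inter> (A \<union> B) = {}"
  proof -
    have "x \<notin> A \<union> B" if x: "x \<in> set (butlast (tl es))" for x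
    proof -
      obtain i where "i < length (butlast (tl es))" "x = butlast (tl es) ! i"
        using x unfolding in_set_conv_nth by blast
      then have "x = es ! Suc i" "Suc (Suc i) < n" by (auto simp: nth_butlast nth_tl n_def)
      then show ?thesis using noA[of "Suc i"] noB[of "Suc i"] by auto
    qed
    then show ?thesis by blast
  qed
  have esE: "set es \<subseteq> edges G" using E by (auto simp: n_def set_conv_nth)
  have path: "\<exists>vs. is_path G vs es \<or> is_cycle G vs es \<and> length es = 2"
  proof -
    consider "n = 1" | "n = 2" | "n \<ge> 3" using n0 by linarith
    then show ?thesis
    proof cases
      case 1
      obtain x y where xy: "ends G (es ! 0) = {x, y}" "x \<noteq> y" "x \<in> verts G" "y \<in> verts G"
        using fin_multigraph_endsE[OF G E[of 0]] n0 by auto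
      then have "is_path G [x, y] es" using 1 esE by (simp add: is_path_def is_walk_def n_def)
      then show ?thesis by blast
    next
      \<comment> \<open>A shortest sequence of two edges may consist of parallel edges, since
        consecutive edges are allowed to meet; this is the only source of closed walks.\<close>
      case 2
      then have es2: "es = [es ! 0, es ! 1]"
        by (intro nth_equalityI) (auto simp: n_def less_2_cases_iff)
      have E2: "es ! 0 \<in> edges G" "es ! 1 \<in> edges G" using E 2 by auto
      have ne: "es ! 0 \<noteq> es ! 1" using noB[of 0] lastB 2 by auto
      obtain x where x: "x \<in> ends G (es ! 0)" "x \<in> ends G (es ! 1)"
        using adj[of 0] 2 by (auto simp: line_rel_def)
      obtain y where y: "ends G (es ! 0) = {y, x}" "y \<noteq> x"
        using fin_multigraph_endsE[OF G E2(1)] x(1) by (metis doubleton_eq_iff insertE singletonD)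
      obtain z where z: "ends G (es ! 1) = {x, z}" "z \<noteq> x"
        using fin_multigraph_endsE[OF G E2(2)] x(2) by (metis doubleton_eq_iff insertE singletonD)
      have V: "{x, y, z} \<subseteq> verts G" using fin_multigraph_ends(1)[OF G] E2 y z by blast
      have w: "is_walk G [y, x, z] [es ! 0, es ! 1]" using V E2 y z
        by (auto simp: is_walk_def less_Suc_eq)
      show ?thesis
      proof (cases "y = z")
        case True
        then have "is_cycle G [y, x, z] [es ! 0, es ! 1]" using w y ne by (auto simp: is_cycle_def)
        then show ?thesis using 2 es2 n_def by metis
      next
        case False
        then have "is_path G [y, x, z] [es ! 0, es ! 1]" using w y z by (auto simp: is_path_def)
        then show ?thesis using es2 by metis
      qed
    next
      case 3
      have "\<exists>v. v \<in> ends G (es ! i) \<and> v \<in> ends G (es ! Suc i)" if "Suc i < n" for i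
        using adj[OF that] by (auto simp: line_rel_def)
      then obtain s where s: "\<And>i. Suc i < n \<Longrightarrow> s i \<in> ends G (es ! i) \<and> s i \<in> ends G (es ! Suc i)"
        by metis
      have other: "\<exists>y. y \<in> ends G e \<and> y \<noteq> x" if "e \<in> edges G" for e x
        using fin_multigraph_endsE[OF G that] by (metis insert_iff)
      obtain v0 where v0: "v0 \<in> ends G (es ! 0)" "v0 \<noteq> s 0" using other[OF E] n0 by blast
      obtain vn where vn: "vn \<in> ends G (es ! (n - 1))" "vn \<noteq> s (n - 2)" using other[OF E] n0
        by (meson diff_less zero_less_one)
      \<comment> \<open>Inner vertices are the ones shared by consecutive edges; the outer two are
        chosen as the ends that are not shared. With at least three edges, \<open>far\<close>
        separates everything else, including the first vertex from the last.\<close>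
      define v where "v i = (if i = 0 then v0 else if i = n then vn else s (i - 1))" for i
      have v_prev: "v i \<in> ends G (es ! (i - 1))" if "0 < i" "i \<le> n" for i
        using that s[of "i - 1"] vn(1) by (auto simp: v_def)
      have v_next: "v i \<in> ends G (es ! i)" if "i < n" for i
        using that s[of "i - 1"] v0(1) by (auto simp: v_def)
      have v_neq: "v i \<noteq> v j" if ij: "i < j" "j \<le> n" for i j
      proof
        assume eq: "v i = v j"
        have disj: "\<not> Suc p < q" if "q < n" "v i \<in> ends G (es ! p)" "v i \<in> ends G (es ! q)" for p q
          using far[of p q] that by blast
        consider "i = 0" "j = 1" | "i = 0" "j = n" | "i = 0" "1 < j" "j < n" | "0 < i" "j < n"
          | "0 < i" "j = n" "i = n - 1" | "0 < i" "j = n" "i < n - 1"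
          using ij by linarith
        then show False
        proof cases
          case 1
          then show ?thesis using eq v0 3 by (simp add: v_def)
        next
          case 2
          then show ?thesis using disj[of "n - 1" 0] v_next[of 0] v_prev[of n] eq 3 by simp
        next
          case 3
          then show ?thesis using disj[of j 0] v_next[of 0] v_next[of j] eq n0 by simp
        next
          case 4
          then show ?thesis using disj[of j "i - 1"] v_prev[of i] v_next[of j] eq ij by simp
        next
          case 5
          then have "v i = s (n - 2)" "v j = vn"
            using \<open>n \<ge> 3\<close> by (simp_all add: v_def numeral_2_eq_2 less_imp_neq)
          then show ?thesis using eq vn(2) by simp
        next
          case 6
          then show ?thesis using disj[of "n - 1" "i - 1"] v_prev[of i] v_prev[of n] eq ij by simp
        qed
      qed
      have ends: "ends G (es ! i) = {v i, v (Suc i)}" if "i < n" for i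
        using ends_eq_insert[OF G E[OF that] v_next[OF that] _ v_neq[of i "Suc i"]] v_prev[of "Suc i"] that
        by simp
      let ?vs = "map v [0..<Suc n]"
      have nth: "?vs ! i = v i" if "i \<le> n" for i using that by (simp del: upt_Suc)
      have "v i \<in> verts G" if "i \<le> n" for i
      proof (cases "i < n")
        case True
        then show ?thesis using v_next[OF True] fin_multigraph_ends(1)[OF G E[OF True]] by blast
      next
        case False
        then have "i = n" "n - 1 < n" using that n0 by auto
        then show ?thesis using v_prev[of n] fin_multigraph_ends(1)[OF G E[of "n - 1"]] n0 by blast
      qed
      then have "set ?vs \<subseteq> verts G" by auto
      moreover have "\<forall>i<length es. ends G (es ! i) = {?vs ! i, ?vs ! Suc i}"
        using ends nth by (simp add: n_def del: upt_Suc)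
      moreover have "inj_on v {0..<Suc n}"
      proof (rule inj_onI)
        fix i j assume "i \<in> {0..<Suc n}" "j \<in> {0..<Suc n}" "v i = v j"
        then show "i = j" using v_neq[of i j] v_neq[of j i] by (cases i j rule: linorder_cases) auto
      qed
      then have "distinct ?vs" by (simp add: distinct_map del: upt_Suc)
      ultimately have "is_path G ?vs es"
        using esE by (simp add: is_path_def is_walk_def n_def del: upt_Suc)
      then show ?thesis by blast
    qed
  qed
  have "links_sets G A B es" unfolding links_sets_def
    using path es inner by (simp add: ok_def)
  then show ?thesis using that setC by blast
qed

text \<open>A separator \<open>S\<close> of the line graph is a set of edges, while uncrossing needs
  a vertex set. \<open>U\<close> consists of the vertices covered by the edges that \<open>A\<close>
  reaches outside \<open>S\<close>; an edge not in \<open>S\<close> that touches \<open>U\<close> is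
  itself reached, hence lies inside \<open>U\<close> and not in \<open>B\<close>.\<close>

theorem no_linkage_sepset:
  assumes G: "fin_multigraph G" and A: "A \<subseteq> edges G" and B: "B \<subseteq> edges G"
    and no: "\<not> edge_disjoint_linkage G A B k"
  shows "\<exists>U\<subseteq>verts G. card (sepset G A B U) < k"
proof -
  have finE: "finite (edges G)" using G by (simp add: fin_multigraph_def)
  have "line_rel G \<subseteq> edges G \<times> edges G" by (auto simp: line_rel_def)
  then have finL: "finite (line_rel G)" using finE by (meson finite_SigmaI finite_subset)
  have "\<exists>S. finite S \<and> separates (line_rel G) S A B \<and> card S < k"
  proof (rule ccontr)
    assume "\<not> ?thesis"
    then obtain C where C: "\<forall>i<k. joins (line_rel G) (C i) A B" "disjoint_family_on C {..<k}"
      using menger[OF finL finite_subset[OF A finE] finite_subset[OF B finE], of k]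
      by (meson linorder_not_less)
    have "\<forall>i<k. \<exists>es. links_sets G A B es \<and> set es \<subseteq> C i"
      using C(1) joins_line_rel_linksE[OF G A B] by metis
    then obtain P where P: "\<And>i. i < k \<Longrightarrow> links_sets G A B (P i) \<and> set (P i) \<subseteq> C i" by metis
    have "disjoint_family_on (\<lambda>i. set (P i)) {..<k}"
      unfolding disjoint_family_on_def
    proof (intro ballI impI)
      fix i j assume "i \<in> {..<k}" "j \<in> {..<k}" "i \<noteq> j"
      then have "set (P i) \<subseteq> C i" "set (P j) \<subseteq> C j" "C i \<inter> C j = {}"
        using P C(2) by (auto simp: disjoint_family_on_def)
      then show "set (P i) \<inter> set (P j) = {}" by blast
    qed
    then show False using no P unfolding edge_disjoint_linkage_def by blast
  qed
  then obtain S where S: "finite S" "separates (line_rel G) S A B" "card S < k" by blast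
  define Q where "Q = {f. \<exists>e\<in>A - S. (e, f) \<in> (Restr (line_rel G) (- S))\<^sup>*}"
  have QE: "f \<in> edges G \<and> f \<notin> S" if f: "f \<in> Q" for f
  proof -
    obtain e where e: "e \<in> A - S" "(e, f) \<in> (Restr (line_rel G) (- S))\<^sup>*"
      using f unfolding Q_def by blast
    show ?thesis using e(2,1) A by (cases rule: rtrancl.cases) (auto simp: line_rel_def)
  qed
  have Qstep: "g \<in> Q" if "f \<in> Q" "g \<in> edges G" "g \<notin> S" "ends G f \<inter> ends G g \<noteq> {}" for f g
  proof -
    have "(f, g) \<in> Restr (line_rel G) (- S)" using that QE by (auto simp: line_rel_def)
    then show ?thesis using that(1) unfolding Q_def by (blast intro: rtrancl.rtrancl_into_rtrancl)
  qed
  define U where "U = (\<Union>f\<in>Q. ends G f)"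
  have "U \<subseteq> verts G" using QE fin_multigraph_ends(1)[OF G] by (auto simp: U_def)
  have touch: "g \<in> Q" if "g \<in> edges G" "g \<notin> S" "ends G g \<inter> U \<noteq> {}" for g
    using that Qstep by (auto simp: U_def)
  have "sepset G A B U \<subseteq> S"
  proof
    fix g assume "g \<in> sepset G A B U"
    then have g: "g \<in> edges G" "g \<in> A \<and> \<not> ends G g \<subseteq> U \<or> g \<in> B \<and> ends G g \<inter> U \<noteq> {} \<or> g \<in> edge_cut G U"
      by (auto simp: sepset_def)
    show "g \<in> S"
    proof (rule ccontr)
      assume gS: "g \<notin> S"
      have inside: "g \<in> Q \<Longrightarrow> ends G g \<subseteq> U" by (auto simp: U_def)
      have AQ: "g \<in> A \<Longrightarrow> g \<in> Q" using gS by (auto simp: Q_def)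
      have "g \<in> B \<Longrightarrow> g \<notin> Q" using S(2) gS by (auto simp: separates_def Q_def)
      then show False using g(2) AQ inside touch[OF g(1) gS] by (auto simp: edge_cut_def)
    qed
  qed
  then have "card (sepset G A B U) \<le> card S" using S(1) card_mono by blast
  then show ?thesis using S(3) \<open>U \<subseteq> verts G\<close> by (intro exI[of _ U]) simp
qed


section \<open>Trees and edge cuts\<close>

lemma edge_cut_compl:
  assumes "fin_multigraph G" "W \<subseteq> verts G"
  shows "edge_cut G (verts G - W) = edge_cut G W"
  using fin_multigraph_ends(1)[OF assms(1)] assms(2) by (auto simp: edge_cut_def)

lemma edge_cut_iff:
  assumes "ends G e = {x, y}"
  shows "e \<in> edge_cut G W \<longleftrightarrow> e \<in> edges G \<and> (x \<in> W \<longleftrightarrow> y \<notin> W)"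
  using assms by (auto simp: edge_cut_def)

lemma is_walk_crosses:
  assumes w: "is_walk G vs es" and "hd vs \<in> W" and "last vs \<notin> W"
  obtains i where "i < length es" "vs ! i \<in> W" "vs ! Suc i \<notin> W" "es ! i \<in> edge_cut G W"
proof -
  have len: "length vs = Suc (length es)" using w by (simp add: is_walk_def)
  then have v0: "vs ! 0 \<in> W" "vs ! length es \<notin> W"
    using assms(2,3) by (auto simp: hd_conv_nth last_conv_nth simp flip: length_greater_0_conv)
  have "\<exists>i<length es. vs ! i \<in> W \<and> vs ! Suc i \<notin> W"
  proof (rule ccontr)
    assume no: "\<not> ?thesis"
    have "i \<le> length es \<Longrightarrow> vs ! i \<in> W" for i
      by (induction i) (use no v0 in auto)
    then show False using v0 by blast
  qed
  then obtain i where i: "i < length es" "vs ! i \<in> W" "vs ! Suc i \<notin> W" by blast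
  have "ends G (es ! i) = {vs ! i, vs ! Suc i}" "es ! i \<in> edges G"
    using w i(1) by (auto simp: is_walk_def)
  then have "es ! i \<in> edge_cut G W" using i by (simp add: edge_cut_iff)
  then show ?thesis using that i by blast
qed

lemma is_path_Nil: "v \<in> verts G \<Longrightarrow> is_path G [v] []"
  by (simp add: is_path_def is_walk_def)

lemma is_walk_append:
  assumes w: "is_walk G vs es" and e: "e \<in> edges G" "ends G e = {last vs, z}" and z: "z \<in> verts G"
  shows "is_walk G (vs @ [z]) (es @ [e])"
proof -
  have len: "length vs = Suc (length es)" using w by (simp add: is_walk_def)
  then have "last vs = vs ! length es" by (subst last_conv_nth) auto
  then show ?thesis using w e z len
    by (auto simp: is_walk_def nth_append less_Suc_eq)
qed

lemma reachable_step:
  assumes G: "fin_multigraph G" and r: "reachable G u v" and e: "e \<in> edges G" "ends G e = {v, z}"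
  shows "reachable G u z"
proof -
  obtain vs es where p: "is_path G vs es" "hd vs = u" "last vs = v"
    using r by (auto simp: reachable_def)
  then have w: "is_walk G vs es" and len: "length vs = Suc (length es)"
    by (auto simp: is_path_def is_walk_def)
  have z: "z \<in> verts G" using fin_multigraph_ends(1)[OF G e(1)] e(2) by simp
  show ?thesis
  proof (cases "z \<in> set vs")
    case True
    then obtain i where i: "i < length vs" "vs ! i = z" by (auto simp: in_set_conv_nth)
    have "set (take (Suc i) vs) \<subseteq> set vs" "set (take i es) \<subseteq> set es" by (rule set_take_subset)+
    then have "is_path G (take (Suc i) vs) (take i es)"
      using p(1) i len by (auto simp: is_path_def is_walk_def)
    moreover have "hd (take (Suc i) vs) = u" using p(2) by simp
    moreover have "last (take (Suc i) vs) = z" using i by (simp add: take_Suc_conv_app_nth)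
    ultimately show ?thesis unfolding reachable_def by blast
  next
    case False
    then have "is_path G (vs @ [z]) (es @ [e])"
      using is_walk_append[OF w e(1) _ z] e(2) p by (auto simp: is_path_def)
    moreover have "hd (vs @ [z]) = u" using p(2) len by (cases vs) auto
    ultimately show ?thesis unfolding reachable_def by (metis last_snoc)
  qed
qed

lemma edge_cut_reachable_empty:
  assumes "fin_multigraph G"
  shows "edge_cut G {t \<in> verts G. reachable G u t} = {}"
proof (rule ccontr)
  let ?W = "{t \<in> verts G. reachable G u t}"
  assume "edge_cut G ?W \<noteq> {}"
  then obtain e where e: "e \<in> edge_cut G ?W" by blast
  then have eE: "e \<in> edges G" by (simp add: edge_cut_def)
  obtain x y where xy: "ends G e = {x, y}" "x \<in> verts G" "y \<in> verts G"
    using fin_multigraph_endsE[OF assms eE] by metis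
  then have "reachable G u x \<longleftrightarrow> reachable G u y"
    using reachable_step[OF assms _ eE] by (metis insert_commute)
  then show False using e xy by (auto simp: edge_cut_def)
qed

lemma reachable_refl: "u \<in> verts G \<Longrightarrow> reachable G u u"
  unfolding reachable_def using is_path_Nil[of u G] by (metis last.simps list.sel(1))

lemma reachable_stays:
  assumes "reachable G u t" "u \<in> W" "edge_cut G W = {}"
  shows "t \<in> W"
proof (rule ccontr)
  assume "t \<notin> W"
  obtain vs es where p: "is_path G vs es" "hd vs = u" "last vs = t"
    using assms(1) by (auto simp: reachable_def)
  then have "is_walk G vs es" by (simp add: is_path_def)
  then show False
    by (rule is_walk_crosses[of G vs es W]) (use p \<open>t \<notin> W\<close> assms in auto)
qed

lemma fin_multigraph_del_edge: "fin_multigraph G \<Longrightarrow> fin_multigraph (del_edge G l)"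
  by (auto simp: fin_multigraph_def del_edge_def)

lemma edge_cut_del_edge: "edge_cut (del_edge G l) W = edge_cut G W - {l}"
  by (auto simp: edge_cut_def del_edge_def)

lemma is_path_distinct_edges:
  assumes "is_path G vs es"
  shows "distinct es"
  unfolding distinct_conv_nth
proof (intro allI impI notI)
  fix i j assume ij: "i < length es" "j < length es" "i \<noteq> j" "es ! i = es ! j"
  have d: "distinct vs" "length vs = Suc (length es)"
    using assms by (auto simp: is_path_def is_walk_def)
  have "{vs ! i, vs ! Suc i} = {vs ! j, vs ! Suc j}"
    using assms ij by (metis is_path_def is_walk_def)
  then have "vs ! i = vs ! j \<or> vs ! i = vs ! Suc j \<and> vs ! Suc i = vs ! j"
    by (auto simp: doubleton_eq_iff)
  then show False using d ij by (auto simp: nth_eq_iff_index_eq)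
qed

definition cut_tree :: "('t, 'l) mgraph \<Rightarrow> bool" where
  "cut_tree T \<longleftrightarrow> fin_multigraph T \<and> verts T \<noteq> {} \<and>
     (\<forall>W\<subseteq>verts T. edge_cut T W = {} \<longrightarrow> W = {} \<or> W = verts T) \<and>
     (\<forall>l\<in>edges T. \<exists>W\<subseteq>verts T. edge_cut T W = {l})"

text \<open>The cut \<open>{l}\<close> is that of the component of one end of \<open>l\<close> after
  deleting \<open>l\<close>; if the other end were in it too, a path between the ends would close up
  to a cycle with \<open>l\<close>.\<close>

lemma is_tree_imp_cut_tree:
  assumes "is_tree T"
  shows "cut_tree T"
proof -
  have T: "fin_multigraph T" "verts T \<noteq> {}" "\<And>u v. u \<in> verts T \<Longrightarrow> v \<in> verts T \<Longrightarrow> reachable T u v"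
    "\<And>vs es. \<not> is_cycle T vs es"
    using assms by (auto simp: is_tree_def)
  have conn: "W = {} \<or> W = verts T" if "W \<subseteq> verts T" "edge_cut T W = {}" for W
    using reachable_stays[OF T(3) _ that(2)] that by blast
  have "\<exists>W\<subseteq>verts T. edge_cut T W = {l}" if l: "l \<in> edges T" for l
  proof -
    let ?D = "del_edge T l"
    obtain u v where uv: "ends T l = {u, v}" "u \<noteq> v" "u \<in> verts T" "v \<in> verts T"
      using fin_multigraph_endsE[OF T(1) l] .
    define W where "W = {t \<in> verts ?D. reachable ?D u t}"
    have VD: "verts ?D = verts T" by (simp add: del_edge_def)
    have "edge_cut T W - {l} = {}"
      using edge_cut_reachable_empty[OF fin_multigraph_del_edge[OF T(1)]]
      unfolding W_def edge_cut_del_edge[symmetric] .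
    moreover have uW: "u \<in> W" using reachable_refl[of u ?D] uv VD by (simp add: W_def)
    have "v \<notin> W"
    proof
      assume "v \<in> W"
      then obtain vs es where p: "is_path ?D vs es" "hd vs = u" "last vs = v"
        by (auto simp: W_def reachable_def)
      have es: "set es \<subseteq> edges T - {l}" and w: "is_walk T vs es" and vs: "vs \<noteq> []" "distinct vs"
        using p(1) by (auto simp: is_path_def is_walk_def del_edge_def)
      have "is_walk T (vs @ [u]) (es @ [l])"
        using is_walk_append[OF w l _ uv(3)] uv(1) p(3) by (simp add: insert_commute)
      moreover have "distinct (es @ [l])" using is_path_distinct_edges[OF p(1)] es by auto
      moreover have "distinct (tl (vs @ [u]))" using vs p(2) by (cases vs) auto
      moreover have "hd (vs @ [u]) = last (vs @ [u])" using vs p(2) by simp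
      ultimately have "is_cycle T (vs @ [u]) (es @ [l])" by (simp add: is_cycle_def)
      then show False using T(4) by blast
    qed
    then have "l \<in> edge_cut T W" using uW uv(1) l by (simp add: edge_cut_iff)
    ultimately have "edge_cut T W = {l}" by blast
    moreover have "W \<subseteq> verts T" using VD by (auto simp: W_def)
    ultimately show ?thesis by blast
  qed
  then show ?thesis using T conn by (simp add: cut_tree_def)
qed

lemma is_walk_tl:
  assumes "is_walk G vs es" "es \<noteq> []"
  shows "is_walk G (tl vs) (tl es)"
proof -
  obtain v vs' where "vs = v # vs'" using assms by (cases vs) (auto simp: is_walk_def)
  moreover obtain e es' where "es = e # es'" using assms by (cases es) auto
  ultimately show ?thesis using assms by (auto simp: is_walk_def)
qed

text \<open>A cycle through \<open>l\<close> would return to its start without \<open>l\<close> and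
  so would cross the cut \<open>{l}\<close> at a second link.\<close>

lemma cut_tree_imp_is_tree:
  assumes "cut_tree T"
  shows "is_tree T"
proof -
  have T: "fin_multigraph T" "verts T \<noteq> {}" using assms by (auto simp: cut_tree_def)
  have "reachable T u v" if "u \<in> verts T" "v \<in> verts T" for u v
  proof -
    let ?W = "{t \<in> verts T. reachable T u t}"
    have "?W \<subseteq> verts T" "edge_cut T ?W = {}" using edge_cut_reachable_empty[OF T(1)] by auto
    then have "?W = {} \<or> ?W = verts T" using assms unfolding cut_tree_def by blast
    moreover have "u \<in> ?W" using reachable_refl that by simp
    ultimately show ?thesis using that by blast
  qed
  moreover have False if c: "is_cycle T vs es" for vs es
  proof -
    have w: "is_walk T vs es" "es \<noteq> []" "hd vs = last vs" "distinct es"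
      using c by (auto simp: is_cycle_def)
    obtain l es' where es: "es = l # es'" using w(2) by (cases es) auto
    obtain u v vs' where vs: "vs = u # v # vs'"
      using w(1) es by (auto simp: is_walk_def length_Suc_conv)
    have l: "l \<in> edges T" "ends T l = {u, v}" "l \<notin> set es'"
      using w es vs by (auto simp: is_walk_def)
    have "\<exists>W\<subseteq>verts T. edge_cut T W = {l}" using assms l(1) by (simp add: cut_tree_def)
    then obtain W where W: "W \<subseteq> verts T" "edge_cut T W = {l}" by blast
    have w': "is_walk T (v # vs') es'" using is_walk_tl[OF w(1,2)] es vs by simp
    have last: "last (v # vs') = u" using w(3) vs by simp
    have uvT: "u \<in> verts T" "v \<in> verts T" using fin_multigraph_ends(1)[OF T(1) l(1)] l(2) by auto
    have "u \<in> W \<longleftrightarrow> v \<notin> W" using W(2) edge_cut_iff[OF l(2), of W] by blast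
    then consider "v \<in> W" "u \<notin> W" | "v \<in> verts T - W" "u \<notin> verts T - W" using uvT by blast
    then show False
    proof cases
      case 1
      show False by (rule is_walk_crosses[OF w', of W]) (use 1 last W(2) l(3) in auto)
    next
      case 2
      show False by (rule is_walk_crosses[OF w', of "verts T - W"])
          (use 2 last W(2) l(3) edge_cut_compl[OF T(1) W(1)] in auto)
    qed
  qed
  ultimately show ?thesis using T unfolding is_tree_def by blast
qed

lemma is_tree_iff_cut_tree: "is_tree T \<longleftrightarrow> cut_tree T"
  using is_tree_imp_cut_tree cut_tree_imp_is_tree by blast

context
  fixes T :: "('t, 'l) mgraph"
  assumes T: "cut_tree T"
begin

lemma cut_tree_fin: "fin_multigraph T"
  using T by (simp add: cut_tree_def)

lemma cut_tree_trivial: "W \<subseteq> verts T \<Longrightarrow> edge_cut T W = {} \<Longrightarrow> W = {} \<or> W = verts T"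
  using T by (simp add: cut_tree_def)

lemma cut_tree_endsE:
  assumes "edge_cut T W = {l}" "W \<subseteq> verts T"
  obtains x y where "ends T l = {x, y}" "x \<in> W" "y \<in> verts T - W"
proof -
  have l: "l \<in> edges T" using assms by (auto simp: edge_cut_def)
  obtain u v where uv: "ends T l = {u, v}" "u \<in> verts T" "v \<in> verts T"
    using fin_multigraph_endsE[OF cut_tree_fin l] by metis
  then have "u \<in> W \<longleftrightarrow> v \<notin> W" using assms(1) edge_cut_iff[OF uv(1), of W] by blast
  then show ?thesis using uv that[of u v] that[of v u] by (auto simp: insert_commute)
qed

text \<open>The symmetric difference of two sides of the same link has an empty cut, so it is
  trivial.\<close>

lemma cut_tree_side_unique:
  assumes "W \<subseteq> verts T" "W' \<subseteq> verts T" "edge_cut T W = {l}" "edge_cut T W' = {l}"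
  shows "W = W' \<or> W = verts T - W'"
proof -
  let ?D = "(W - W') \<union> (W' - W)"
  obtain x y where xy: "ends T l = {x, y}" "x \<in> W" "y \<in> verts T - W"
    using cut_tree_endsE[OF assms(3,1)] .
  have "x \<in> W' \<longleftrightarrow> y \<notin> W'" using assms(4) edge_cut_iff[OF xy(1), of W'] by blast
  then have "l \<notin> edge_cut T ?D" using xy by (auto simp: edge_cut_iff[OF xy(1)])
  moreover have "edge_cut T ?D \<subseteq> edge_cut T W \<union> edge_cut T W'"
  proof
    fix e assume e: "e \<in> edge_cut T ?D"
    then have "e \<in> edges T" by (simp add: edge_cut_def)
    then obtain p q where pq: "ends T e = {p, q}"
      using fin_multigraph_endsE[OF cut_tree_fin] by metis
    show "e \<in> edge_cut T W \<union> edge_cut T W'" using e unfolding Un_iff edge_cut_iff[OF pq] by blast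
  qed
  ultimately have "edge_cut T ?D = {}" unfolding assms(3,4) by blast
  then have "?D = {} \<or> ?D = verts T" using assms by (intro cut_tree_trivial) auto
  then show ?thesis using assms by blast
qed

text \<open>Since \<open>b\<close> has no end in \<open>W\<close>, both \<open>W \<inter> W'\<close>
  and \<open>W - W'\<close> can only be cut by \<open>e\<close>. The one that misses the end of
  \<open>e\<close> in \<open>W\<close> has an empty cut and is therefore empty.\<close>

lemma cut_tree_sides_nested:
  assumes W: "W \<subseteq> verts T" "edge_cut T W = {e}" and W': "W' \<subseteq> verts T" "edge_cut T W' = {b}"
    and out: "ends T b \<inter> W = {}"
  shows "W \<subseteq> W' \<or> W \<inter> W' = {}"
proof -
  have sub: "edge_cut T (W \<inter> D) \<subseteq> {e}" if D: "D = W' \<or> D = - W'" for D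
  proof
    fix g assume g: "g \<in> edge_cut T (W \<inter> D)"
    then have "g \<in> edges T" by (simp add: edge_cut_def)
    then obtain p q where pq: "ends T g = {p, q}"
      using fin_multigraph_endsE[OF cut_tree_fin] by metis
    have "g \<noteq> b" using g out by (auto simp: edge_cut_def)
    then have "g \<notin> edge_cut T W'" using W' by simp
    then have "g \<in> edge_cut T W" using g D unfolding edge_cut_iff[OF pq] by blast
    then show "g \<in> {e}" using W by simp
  qed
  obtain x y where xy: "ends T e = {x, y}" "x \<in> W" "y \<in> verts T - W"
    using cut_tree_endsE[OF W(2,1)] .
  have triv: "W \<inter> D = {}" if D: "D = W' \<or> D = - W'" "x \<notin> D" for D
  proof -
    have "e \<notin> edge_cut T (W \<inter> D)" using xy D(2) by (auto simp: edge_cut_def)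
    then have "edge_cut T (W \<inter> D) = {}" using sub[OF D(1)] by blast
    then have "W \<inter> D = {} \<or> W \<inter> D = verts T" using W by (intro cut_tree_trivial) auto
    then show ?thesis using xy by blast
  qed
  show ?thesis using triv[of W'] triv[of "- W'"] by auto
qed

text \<open>Connects the path-based \<open>side_bags\<close> with cuts: the component of
  \<open>u\<close> lies inside \<open>W\<close> and its cut is contained in \<open>{l}\<close>, but
  not empty because \<open>T\<close> is connected; uniqueness of sides identifies it with
  \<open>W\<close>.\<close>

lemma reachable_del_edge_iff:
  assumes W: "W \<subseteq> verts T" "edge_cut T W = {l}" and u: "u \<in> W" and t: "t \<in> verts T"
    and "u \<in> ends T l"
  shows "reachable (del_edge T l) u t \<longleftrightarrow> t \<in> W"
proof -
  let ?D = "del_edge T l"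
  let ?R = "{t \<in> verts T. reachable ?D u t}"
  have VD: "verts ?D = verts T" by (simp add: del_edge_def)
  have cR: "edge_cut T ?R \<subseteq> {l}"
    using edge_cut_reachable_empty[OF fin_multigraph_del_edge[OF cut_tree_fin, of l], of u]
    unfolding edge_cut_del_edge VD by blast
  have RW: "?R \<subseteq> W"
    using reachable_stays[of ?D u _ W] u W(2) by (auto simp: edge_cut_del_edge)
  have uR: "u \<in> ?R" using reachable_refl[of u ?D] u W(1) VD by auto
  obtain x y where xy: "ends T l = {x, y}" "x \<in> W" "y \<in> verts T - W"
    using cut_tree_endsE[OF W(2,1)] .
  have "edge_cut T ?R \<noteq> {}" using cut_tree_trivial[of ?R] RW uR xy by blast
  then have "edge_cut T ?R = {l}" using cR by blast
  then have "?R = W \<or> ?R = verts T - W" using W by (intro cut_tree_side_unique) auto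
  then have "?R = W" using u uR by blast
  then show ?thesis using t by blast
qed

text \<open>Turns the size of an adhesion into a value of the cut function of \<open>G\<close>, to
  which submodularity applies.\<close>

lemma adh_eq_cut:
  assumes X: "disjoint_family_on X (verts T)" "(\<Union>t\<in>verts T. X t) = verts G" and G: "fin_multigraph G"
    and W: "W \<subseteq> verts T" "edge_cut T W = {l}"
  shows "adh G T X l = edge_cut G (\<Union>t\<in>W. X t)"
proof -
  obtain u v where uv: "ends T l = {u, v}" "u \<in> W" "v \<in> verts T - W"
    using cut_tree_endsE[OF W(2,1)] .
  let ?Y = "\<Union>t\<in>W. X t" and ?Z = "\<Union>t\<in>verts T - W. X t"
  have W': "verts T - W \<subseteq> verts T" "edge_cut T (verts T - W) = {l}"
    using edge_cut_compl[OF cut_tree_fin W(1)] W by auto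
  have "{t \<in> verts T. reachable (del_edge T l) u t} = W"
    using reachable_del_edge_iff[OF W uv(2)] uv(1) W(1) by auto
  then have su: "side_bags T X l u = ?Y" by (simp add: side_bags_def)
  have "{t \<in> verts T. reachable (del_edge T l) v t} = verts T - W"
    using reachable_del_edge_iff[OF W' uv(3)] uv(1) by auto
  then have sv: "side_bags T X l v = ?Z" by (simp add: side_bags_def)
  have disj: "?Y \<inter> ?Z = {}" using X(1) W(1) by (fastforce simp: disjoint_family_on_def)
  have un: "?Y \<union> ?Z = verts G" using X(2) W(1) by blast
  have "e \<in> adh G T X l \<longleftrightarrow> e \<in> edge_cut G ?Y" for e
  proof (cases "e \<in> edges G")
    case True
    obtain p q where pq: "ends G e = {p, q}" "p \<in> verts G" "q \<in> verts G" 
      using fin_multigraph_endsE[OF G True] by metis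
    have "e \<in> adh G T X l \<longleftrightarrow> (\<exists>x y. x \<in> ?Y \<and> y \<in> ?Z \<and> ends G e = {x, y})"
    proof
      assume "e \<in> adh G T X l"
      then obtain u' v' x y where *: "ends T l = {u', v'}" "x \<in> side_bags T X l u'"
        "y \<in> side_bags T X l v'" "ends G e = {x, y}" unfolding adh_def by blast
      then have "u' = u \<and> v' = v \<or> u' = v \<and> v' = u" using uv(1) by (auto simp: doubleton_eq_iff)
      then show "\<exists>x y. x \<in> ?Y \<and> y \<in> ?Z \<and> ends G e = {x, y}"
      proof
        assume "u' = u \<and> v' = v"
        then show "\<exists>x y. x \<in> ?Y \<and> y \<in> ?Z \<and> ends G e = {x, y}"
          using * unfolding su[symmetric] sv[symmetric] by blast
      next
        assume "u' = v \<and> v' = u"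
        then have "y \<in> side_bags T X l u" "x \<in> side_bags T X l v" "ends G e = {y, x}"
          using * by auto
        then show "\<exists>x y. x \<in> ?Y \<and> y \<in> ?Z \<and> ends G e = {x, y}"
          unfolding su[symmetric] sv[symmetric] by blast
      qed
    next
      assume "\<exists>x y. x \<in> ?Y \<and> y \<in> ?Z \<and> ends G e = {x, y}"
      then obtain x y where *: "x \<in> side_bags T X l u" "y \<in> side_bags T X l v" "ends G e = {x, y}"
        unfolding su sv by blast
      moreover have "u \<noteq> v" using uv by auto
      ultimately show "e \<in> adh G T X l" unfolding adh_def using uv(1) True by blast
    qed
    also have "\<dots> \<longleftrightarrow> e \<in> edge_cut G ?Y"
    proof
      assume "\<exists>x y. x \<in> ?Y \<and> y \<in> ?Z \<and> ends G e = {x, y}"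
      then obtain x y where "x \<in> ?Y" "y \<in> ?Z" "ends G e = {x, y}" by blast
      then show "e \<in> edge_cut G ?Y" using disj True by (subst edge_cut_iff) blast+
    next
      assume "e \<in> edge_cut G ?Y"
      then have "p \<in> ?Y \<longleftrightarrow> q \<notin> ?Y" using edge_cut_iff[OF pq(1)] by blast
      then have "p \<in> ?Y \<and> q \<in> ?Z \<or> q \<in> ?Y \<and> p \<in> ?Z" using un pq by blast
      then show "\<exists>x y. x \<in> ?Y \<and> y \<in> ?Z \<and> ends G e = {x, y}" using pq(1) by blast
    qed
    finally show ?thesis .
  qed (auto simp: adh_def edge_cut_def)
  then show ?thesis by blast
qed

text \<open>Links that separate \<open>e\<close> from \<open>g\<close>; these are the links of the path from \<open>e\<close> to \<open>g\<close>,
  including its first and last link.\<close>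

definition between :: "'l \<Rightarrow> 'l \<Rightarrow> 'l set" where
  "between e g = {c. \<exists>W\<subseteq>verts T. edge_cut T W = {c} \<and> ends T e \<inter> W \<noteq> {} \<and> \<not> ends T g \<subseteq> W}"

text \<open>Carries the lower bound on adhesions that a failure of leanness gives along the path
  over to all of \<open>between T a b\<close>.\<close>

lemma between_on_link_path:
  assumes a: "a \<in> edges T" and b: "b \<in> edges T" and c: "c \<in> between a b"
  shows "on_link_path T a b c"
proof -
  have split: "ends T l \<subseteq> W \<or> ends T l \<inter> W = {}" if "edge_cut T W = {m}" "l \<in> edges T" "l \<noteq> m" for W l m
    using that by (auto simp: edge_cut_def)
  obtain W where W: "W \<subseteq> verts T" "edge_cut T W = {c}" "ends T a \<inter> W \<noteq> {}" "\<not> ends T b \<subseteq> W"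
    using c by (auto simp: between_def)
  show ?thesis
  proof (cases "a = b")
    case True
    then have "c = a" using W a by (auto simp: edge_cut_def)
    moreover obtain x y where xy: "ends T a = {x, y}" "x \<noteq> y" "x \<in> verts T" "y \<in> verts T"
      using fin_multigraph_endsE[OF cut_tree_fin a] .
    have "is_path T [x, y] [a]" using xy a by (simp add: is_path_def is_walk_def)
    ultimately show ?thesis using True unfolding on_link_path_def by fastforce
  next
    case False
    have side: "\<exists>V\<subseteq>verts T. edge_cut T V = {l} \<and> ends T m \<inter> V = {}"
      if lm: "l \<in> edges T" "m \<in> edges T" "m \<noteq> l" for l m
    proof -
      have "\<exists>V\<subseteq>verts T. edge_cut T V = {l}" using T lm(1) by (simp add: cut_tree_def)
      then obtain V where V: "V \<subseteq> verts T" "edge_cut T V = {l}" by blast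
      show ?thesis
      proof (cases "ends T m \<inter> V = {}")
        case False
        then have "ends T m \<subseteq> V" using split[OF V(2) lm(2,3)] by blast
        then show ?thesis using edge_cut_compl[OF cut_tree_fin V(1)] V(2)
          by (intro exI[of _ "verts T - V"]) auto
      qed (use V in blast)
    qed
    \<comment> \<open>The path is taken between the end of \<open>a\<close> away from
      \<open>b\<close> and the end of \<open>b\<close> away from \<open>a\<close>. It leaves
      \<open>Va\<close> through \<open>a\<close>, at its first vertex by distinctness, and enters
      \<open>Vb\<close> through \<open>b\<close> at its last one; every other cut that separates
      \<open>a\<close> from \<open>b\<close> is crossed on the way.\<close>
    obtain Va where Va: "Va \<subseteq> verts T" "edge_cut T Va = {a}" "ends T b \<inter> Va = {}"
      using side[OF a b] False by blast
    obtain Vb where Vb: "Vb \<subseteq> verts T" "edge_cut T Vb = {b}" "ends T a \<inter> Vb = {}"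
      using side[OF b a] False by blast
    obtain a0 a1 where a0: "ends T a = {a0, a1}" "a0 \<in> Va" "a1 \<in> verts T - Va"
      using cut_tree_endsE[OF Va(2,1)] .
    obtain b1 b0 where b1: "ends T b = {b1, b0}" "b1 \<in> Vb" "b0 \<in> verts T - Vb"
      using cut_tree_endsE[OF Vb(2,1)] .
    have "reachable T a0 b1"
      using cut_tree_imp_is_tree[OF T] a0 b1 Va(1) Vb(1) unfolding is_tree_def by blast
    then obtain vs ls where p: "is_path T vs ls" "hd vs = a0" "last vs = b1"
      by (auto simp: reachable_def)
    have w: "is_walk T vs ls" and d: "distinct vs" and len: "length vs = Suc (length ls)"
      using p by (auto simp: is_path_def is_walk_def)
    have vs0: "vs ! 0 = a0" "vs ! length ls = b1" using p len
      by (auto simp: hd_conv_nth last_conv_nth simp flip: length_greater_0_conv)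
    have E: "ends T (ls ! i) = {vs ! i, vs ! Suc i}" if "i < length ls" for i using w that
      by (simp add: is_walk_def)
    obtain i where i: "i < length ls" "vs ! i \<in> Va" "vs ! Suc i \<notin> Va" "ls ! i \<in> edge_cut T Va"
      using is_walk_crosses[OF w, of Va] p a0 b1 Va by blast
    then have lsi: "ls ! i = a" using Va by simp
    then have "vs ! i = a0" using E[OF i(1)] a0 i by (auto simp: doubleton_eq_iff)
    then have "i = 0" using d vs0 i len by (metis less_Suc_eq nth_eq_iff_index_eq zero_less_Suc)
    then have ne: "ls \<noteq> []" and hd: "hd ls = a" using i lsi by (auto simp: hd_conv_nth)
    obtain j where j: "j < length ls" "vs ! j \<in> verts T - Vb" "vs ! Suc j \<notin> verts T - Vb" "ls ! j \<in> edge_cut T (verts T - Vb)"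
      using is_walk_crosses[OF w, of "verts T - Vb"] p a0 b1 Va Vb by blast
    then have lsj: "ls ! j = b" using Vb edge_cut_compl[OF cut_tree_fin Vb(1)] by simp
    then have "vs ! Suc j = b1" using E[OF j(1)] b1 j by (auto simp: doubleton_eq_iff)
    then have "Suc j = length ls" using d vs0 j len by (metis Suc_less_eq lessI nth_eq_iff_index_eq)
    then have last: "last ls = b" using lsj ne by (metis diff_Suc_1 last_conv_nth)
    have "c \<in> set ls"
    proof (cases "c = a \<or> c = b")
      case True
      then show ?thesis using lsi lsj i j nth_mem by blast
    next
      case False
      then have "a0 \<in> W" "b1 \<notin> W" using split[OF W(2) a] split[OF W(2) b] W(3,4) a0 b1 by auto
      then obtain m where "m < length ls" "ls ! m \<in> edge_cut T W"
        using is_walk_crosses[OF w, of W] p by blast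
      then show ?thesis using W(2) nth_mem by fastforce
    qed
    then show ?thesis unfolding on_link_path_def
      using p(1) ne hd last by (intro exI[of _ vs] exI[of _ ls]) simp
  qed
qed

end


section \<open>Uncrossing\<close>

lemma card_add_le_pointwise:
  assumes E: "finite E" and S: "S1 \<subseteq> E" "S2 \<subseteq> E" "S3 \<subseteq> E" "S4 \<subseteq> E"
    and le: "\<And>e. e \<in> E \<Longrightarrow>
      (of_bool (e \<in> S1) + of_bool (e \<in> S2) :: nat) \<le> of_bool (e \<in> S3) + of_bool (e \<in> S4)"
  shows "card S1 + card S2 \<le> card S3 + card S4"
proof -
  have c: "card S = (\<Sum>e\<in>E. of_bool (e \<in> S))" if "S \<subseteq> E" for S
    using that E by (simp add: of_bool_def sum.If_cases Int_absorb1 flip: card_eq_sum)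
  show ?thesis unfolding c[OF S(1)] c[OF S(2)] c[OF S(3)] c[OF S(4)] sum.distrib[symmetric]
    by (rule sum_mono) (rule le)
qed

lemma finite_sepset: "fin_multigraph G \<Longrightarrow> finite (sepset G A B U)"
  by (simp add: fin_multigraph_def sepset_def)

lemma sepset_iff:
  assumes "ends G e = {x, y}" "e \<in> edges G"
  shows "e \<in> sepset G A B U \<longleftrightarrow>
    e \<in> A \<and> (x \<notin> U \<or> y \<notin> U) \<or> e \<in> B \<and> (x \<in> U \<or> y \<in> U) \<or> (x \<in> U \<longleftrightarrow> y \<notin> U)"
  using assms edge_cut_iff[OF assms(1)] by (auto simp: sepset_def)

lemma edge_cut_submodular:
  assumes "fin_multigraph G"
  shows "card (edge_cut G (Y \<inter> U)) + card (edge_cut G (Y \<union> U))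
    \<le> card (edge_cut G Y) + card (edge_cut G U)"
proof (rule card_add_le_pointwise[of "edges G"])
  fix e assume e: "e \<in> edges G"
  obtain x y where "ends G e = {x, y}" using fin_multigraph_endsE[OF assms e] .
  then show "(of_bool (e \<in> edge_cut G (Y \<inter> U)) + of_bool (e \<in> edge_cut G (Y \<union> U)) :: nat)
    \<le> of_bool (e \<in> edge_cut G Y) + of_bool (e \<in> edge_cut G U)"
    using e by (auto simp: edge_cut_iff of_bool_def)
qed (use assms in \<open>auto simp: fin_multigraph_def edge_cut_def\<close>)

text \<open>The inequality holds edge by edge. An edge of \<open>B\<close> inside \<open>Y\<close>
  could enter the separator of \<open>U \<union> Y\<close> with nothing on the right to pay for it,
  which is what the hypothesis on \<open>B\<close> excludes.\<close>

lemma sepset_uncross: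
  assumes "fin_multigraph G" and B: "\<And>e. e \<in> edges G \<Longrightarrow> e \<in> B \<Longrightarrow> \<not> ends G e \<subseteq> Y"
  shows "card (edge_cut G (Y \<inter> U)) + card (sepset G A B (U \<union> Y))
    \<le> card (edge_cut G Y) + card (sepset G A B U)"
proof (rule card_add_le_pointwise[of "edges G"])
  fix e assume e: "e \<in> edges G"
  obtain x y where xy: "ends G e = {x, y}" using fin_multigraph_endsE[OF assms(1) e] .
  have "e \<notin> B \<or> \<not> (x \<in> Y \<and> y \<in> Y)" using B[OF e] xy by simp
  then show "(of_bool (e \<in> edge_cut G (Y \<inter> U)) + of_bool (e \<in> sepset G A B (U \<union> Y)) :: nat)
    \<le> of_bool (e \<in> edge_cut G Y) + of_bool (e \<in> sepset G A B U)"
    unfolding edge_cut_iff[OF xy] sepset_iff[OF xy e]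
   
      by (cases "x \<in> U"; cases "y \<in> U"; cases "x \<in> Y"; cases "y \<in> Y"; cases "e \<in> A"; simp add: e of_bool_def)
qed (use assms in \<open>auto simp: fin_multigraph_def edge_cut_def sepset_def\<close>)

lemma sepset_compl:
  assumes "fin_multigraph G" "U \<subseteq> verts G"
  shows "sepset G B A (verts G - U) = sepset G A B U"
  using fin_multigraph_ends(1)[OF assms(1)] edge_cut_compl[OF assms]
  by (auto simp: sepset_def)

text \<open>The sides of links that do not contain the whole link \<open>c\<close>: every link other than \<open>c\<close>
  contributes its side away from \<open>c\<close>, and \<open>c\<close> contributes both sides.\<close>

definition sides :: "('t, 'l) mgraph \<Rightarrow> 'l \<Rightarrow> 't set set" where
  "sides T c = {W. W \<subseteq> verts T \<and> (\<exists>l. edge_cut T W = {l}) \<and> \<not> ends T c \<subseteq> W}"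

text \<open>Intersecting the two families of sides has two purposes: the count is invariant under
  exchanging \<open>a\<close> with \<open>b\<close> and complementing \<open>U\<close>, and the
  family is laminar, so that adding a member to \<open>U\<close> does not create new
  crossings.\<close>

definition crossed :: "('t, 'l) mgraph \<Rightarrow> ('t \<Rightarrow> 'v set) \<Rightarrow> 'l \<Rightarrow> 'l \<Rightarrow> 'v set \<Rightarrow> 't set set" where
  "crossed T X a b U = {W \<in> sides T a \<inter> sides T b. \<Union>(X ` W) \<inter> U \<noteq> {} \<and> \<not> \<Union>(X ` W) \<subseteq> U}"

context
  fixes T :: "('t, 'l) mgraph"
  assumes T: "cut_tree T"
begin

lemma sidesD:
  assumes "W \<in> sides T c"
  shows "W \<subseteq> verts T" "\<exists>l. edge_cut T W = {l}" "\<not> ends T c \<subseteq> W"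
  using assms by (auto simp: sides_def)

lemma finite_sides: "finite (sides T c)"
proof -
  have "sides T c \<subseteq> Pow (verts T)" by (auto simp: sides_def)
  then show ?thesis using cut_tree_fin[OF T]
    by (meson fin_multigraph_def finite_Pow_iff finite_subset)
qed

lemma not_crossing_ends:
  assumes "edge_cut T W = {l}" "m \<in> edges T" "m \<noteq> l"
  shows "ends T m \<subseteq> W \<or> ends T m \<inter> W = {}"
  using assms by (auto simp: edge_cut_def)

lemma sides_exists:
  assumes "l \<in> edges T" "c \<in> edges T"
  shows "\<exists>W\<in>sides T c. edge_cut T W = {l}"
proof -
  have "\<exists>W\<subseteq>verts T. edge_cut T W = {l}" using T assms(1) by (simp add: cut_tree_def)
  then obtain W where W: "W \<subseteq> verts T" "edge_cut T W = {l}" by blast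
  have W': "edge_cut T (verts T - W) = {l}"
    using edge_cut_compl[OF cut_tree_fin[OF T] W(1)] W(2) by simp
  have "ends T c \<noteq> {}" using fin_multigraph_ends(2)[OF cut_tree_fin[OF T] assms(2)] by auto
  then have "\<not> ends T c \<subseteq> W \<or> \<not> ends T c \<subseteq> verts T - W" by auto
  then show ?thesis
  proof
    assume "\<not> ends T c \<subseteq> W"
    then have "W \<in> sides T c" using W by (simp add: sides_def)
    then show ?thesis using W by blast
  next
    assume "\<not> ends T c \<subseteq> verts T - W"
    then have "verts T - W \<in> sides T c" using W' unfolding sides_def by blast
    then show ?thesis using W' by blast
  qed
qed

lemma sides_subset:
  assumes W: "W \<in> sides T c" and c: "c \<in> edges T"
  shows "\<exists>V\<subseteq>verts T. edge_cut T V = {c} \<and> W \<subseteq> V"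
proof -
  obtain l where l: "edge_cut T W = {l}" using sidesD(2)[OF W] by blast
  show ?thesis
  proof (cases "l = c")
    case True
    then show ?thesis using l sidesD(1)[OF W] by blast
  next
    case False
    then have out: "ends T c \<inter> W = {}" using not_crossing_ends[OF l c] sidesD(3)[OF W] by blast
    have "\<exists>V\<subseteq>verts T. edge_cut T V = {c}" using T c by (simp add: cut_tree_def)
    then obtain V where V: "V \<subseteq> verts T" "edge_cut T V = {c}" by blast
    from cut_tree_sides_nested[OF T sidesD(1)[OF W] l V out]
    show ?thesis
    proof
      assume "W \<inter> V = {}"
      then have "W \<subseteq> verts T - V" using sidesD(1)[OF W] by blast
      then show ?thesis using edge_cut_compl[OF cut_tree_fin[OF T] V(1)] V(2)
        by (intro exI[of _ "verts T - V"]) simp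
    qed (use V in blast)
  qed
qed

lemma sides_eq_or_compl:
  assumes "W \<in> sides T c" "W' \<in> sides T c'" "edge_cut T W = edge_cut T W'"
  shows "W = W' \<or> W = verts T - W'"
proof -
  obtain l where l: "edge_cut T W = {l}" using sidesD(2)[OF assms(1)] by blast
  then have "edge_cut T W' = {l}" using assms(3) by simp
  then show ?thesis using cut_tree_side_unique[OF T sidesD(1)[OF assms(1)] sidesD(1)[OF assms(2)] l]
    by blast
qed

lemma sides_unique:
  assumes "W \<in> sides T c" "W' \<in> sides T c" "edge_cut T W = edge_cut T W'" "edge_cut T W \<noteq> {c}" "c \<in> edges T"
  shows "W = W'"
proof (rule ccontr)
  assume "W \<noteq> W'"
  then have eq: "W = verts T - W'" using sides_eq_or_compl assms by blast
  obtain l where l: "edge_cut T W = {l}" using sidesD(2)[OF assms(1)] by blast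
  then have "l \<noteq> c" "edge_cut T W' = {l}" using assms(3,4) by auto
  then have "ends T c \<inter> W = {}" "ends T c \<inter> W' = {}"
    using not_crossing_ends[OF _ assms(5)] l sidesD(3)[OF assms(1)] sidesD(3)[OF assms(2)] by blast+
  moreover have "ends T c \<subseteq> verts T" "ends T c \<noteq> {}"
    using fin_multigraph_ends[OF cut_tree_fin[OF T] assms(5)] by auto
  ultimately show False using eq by blast
qed

text \<open>The critical case is that \<open>W\<close> and \<open>V\<close> together cover the tree.
  As neither contains the whole link \<open>a\<close>, this link would cross both cuts, although
  they belong to different links.\<close>

lemma sides_laminar:
  assumes W: "W \<in> sides T a" "W \<in> sides T b" and V: "V \<in> sides T a" "V \<in> sides T b"
    and a: "a \<in> edges T"
  shows "W \<subseteq> V \<or> V \<subseteq> W \<or> W \<inter> V = {}"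
proof -
  obtain l where l: "edge_cut T W = {l}" using sidesD(2)[OF W(1)] by blast
  obtain m where m: "edge_cut T V = {m}" using sidesD(2)[OF V(1)] by blast
  have lE: "l \<in> edges T" and mE: "m \<in> edges T" using l m by (auto simp: edge_cut_def)
  show ?thesis
  proof (cases "l = m")
    case True
    then show ?thesis using sides_eq_or_compl[OF W(1) V(1)] l m by auto
  next
    case False
    consider "ends T m \<inter> W = {}" | "ends T l \<inter> V = {}" | "ends T m \<subseteq> W" "ends T l \<subseteq> V"
      using not_crossing_ends[OF l mE] not_crossing_ends[OF m lE] False by blast
    then show ?thesis
    proof cases
      case 1
      then show ?thesis using cut_tree_sides_nested[OF T sidesD(1)[OF W(1)] l sidesD(1)[OF V(1)] m]
        by blast
    next
      case 2
      then show ?thesis using cut_tree_sides_nested[OF T sidesD(1)[OF V(1)] m sidesD(1)[OF W(1)] l]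
        by blast
    next
      case 3
      let ?V = "verts T - V"
      have V': "?V \<subseteq> verts T" "edge_cut T ?V = {m}" "ends T l \<inter> ?V = {}"
        using edge_cut_compl[OF cut_tree_fin[OF T] sidesD(1)[OF V(1)]] m 3 by auto
      have "?V \<subseteq> W \<or> ?V \<inter> W = {}"
        using cut_tree_sides_nested[OF T V'(1,2) sidesD(1)[OF W(1)] l V'(3)] .
      then show ?thesis
      proof
        assume VW: "?V \<subseteq> W"
        have aV: "ends T a \<subseteq> verts T" using fin_multigraph_ends(1)[OF cut_tree_fin[OF T] a] .
        have out: "\<not> ends T a \<subseteq> W" "\<not> ends T a \<subseteq> V" using sidesD(3) W V by auto
        have "ends T a \<inter> W \<noteq> {}" "ends T a \<inter> V \<noteq> {}" using out aV VW by blast+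
        then have "a \<in> edge_cut T W" "a \<in> edge_cut T V" using out a by (auto simp: edge_cut_def)
        then show ?thesis using l m False by auto
      next
        assume "?V \<inter> W = {}"
        then show ?thesis using sidesD(1)[OF W(1)] by blast
      qed
    qed
  qed
qed

lemma between_commute:
  assumes "e \<in> edges T" "g \<in> edges T"
  shows "between T e g = between T g e"
proof -
  have "between T e g \<subseteq> between T g e" if "e \<in> edges T" "g \<in> edges T" for e g
  proof
    fix c assume "c \<in> between T e g"
    then obtain W where W: "W \<subseteq> verts T" "edge_cut T W = {c}" "ends T e \<inter> W \<noteq> {}" "\<not> ends T g \<subseteq> W"
      by (auto simp: between_def[OF T])
    have "ends T g \<inter> (verts T - W) \<noteq> {}" "\<not> ends T e \<subseteq> verts T - W"
      using W(3,4) fin_multigraph_ends(1)[OF cut_tree_fin[OF T]] that by blast+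
    then show "c \<in> between T g e"
      using edge_cut_compl[OF cut_tree_fin[OF T] W(1)] W(2) unfolding between_def[OF T] by blast
  qed
  then show ?thesis using assms by blast
qed

lemma between_self:
  assumes "e \<in> edges T" "g \<in> edges T"
  shows "e \<in> between T e g" "g \<in> between T e g"
proof -
  have *: "e \<in> between T e g" if e: "e \<in> edges T" and g: "g \<in> edges T" for e g
  proof -
    obtain W where W: "W \<in> sides T g" "edge_cut T W = {e}" using sides_exists[OF e g] by blast
    then have "ends T e \<inter> W \<noteq> {}" by (auto simp: edge_cut_def)
    then show ?thesis using W sidesD[OF W(1)] unfolding between_def[OF T] by blast
  qed
  show "e \<in> between T e g" using * assms by blast
  show "g \<in> between T e g" using *[of g e] assms between_commute by blast
qed

end

text \<open>A failure of leanness together with an extremal \<open>U\<close>. All assumptions are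
  stable under exchanging \<open>a\<close>, \<open>A\<close> with \<open>b\<close>, \<open>B\<close>
  and complementing \<open>U\<close>, so each claim about one copy yields the claim about the
  other.\<close>

locale violation =
  fixes G :: "('v, 'e) mgraph" and T :: "('t, 'l) mgraph" and X :: "'t \<Rightarrow> 'v set"
    and a b :: 'l and k :: nat and A B :: "'e set" and U :: "'v set"
  assumes G: "fin_multigraph G" and T: "cut_tree T"
    and X: "disjoint_family_on X (verts T)" "(\<Union>t\<in>verts T. X t) = verts G"
    and a: "a \<in> edges T" and b: "b \<in> edges T"
    and A: "A \<subseteq> adh G T X a" "card A = k" and B: "B \<subseteq> adh G T X b" "card B = k"
    and U: "U \<subseteq> verts G" and small: "card (sepset G A B U) < k"
    and min: "\<And>U'. U' \<subseteq> verts G \<Longrightarrow> card (sepset G A B U) \<le> card (sepset G A B U')"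
    and min_crossed: "\<And>U'. U' \<subseteq> verts G \<Longrightarrow> card (sepset G A B U') \<le> card (sepset G A B U) \<Longrightarrow>
      card (crossed T X a b U) \<le> card (crossed T X a b U')"
    and large: "\<And>c. c \<in> between T a b \<Longrightarrow> k \<le> card (adh G T X c)"
begin

abbreviation d :: "'v set \<Rightarrow> nat" where "d S \<equiv> card (edge_cut G S)"

definition XX :: "'t set \<Rightarrow> 'v set" where "XX W = (\<Union>t\<in>W. X t)"

lemma XX_verts: "W \<subseteq> verts T \<Longrightarrow> XX W \<subseteq> verts G"
  using X(2) by (auto simp: XX_def)

lemma XX_compl: "W \<subseteq> verts T \<Longrightarrow> XX (verts T - W) = verts G - XX W"
  using X by (fastforce simp: XX_def disjoint_family_on_def)

lemma XX_disjoint: "W \<subseteq> verts T \<Longrightarrow> W' \<subseteq> verts T \<Longrightarrow> W \<inter> W' = {} \<Longrightarrow> XX W \<inter> XX W' = {}"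
  using X by (fastforce simp: XX_def disjoint_family_on_def)

lemma adh_d: "W \<subseteq> verts T \<Longrightarrow> edge_cut T W = {l} \<Longrightarrow> card (adh G T X l) = d (XX W)"
  using adh_eq_cut[OF T X G] by (simp add: XX_def)

lemma swap: "violation G T X b a k B A (verts G - U)"
proof -
  have cr: "crossed T X b a (verts G - U') = crossed T X a b U'" if "U' \<subseteq> verts G" for U'
  proof -
    have "W \<in> crossed T X b a (verts G - U') \<longleftrightarrow> W \<in> crossed T X a b U'" for W
    proof (cases "W \<in> sides T a")
      case True
      then have "\<Union>(X ` W) \<subseteq> verts G" using sidesD(1)[OF T True] X(2) by blast
      then have "\<Union>(X ` W) \<inter> (verts G - U') \<noteq> {} \<and> \<not> \<Union>(X ` W) \<subseteq> verts G - U' \<longleftrightarrow>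
        \<Union>(X ` W) \<inter> U' \<noteq> {} \<and> \<not> \<Union>(X ` W) \<subseteq> U'" by blast
      then show ?thesis by (auto simp: crossed_def)
    qed (simp add: crossed_def)
    then show ?thesis by blast
  qed
  show ?thesis
  proof
    fix U' assume U': "U' \<subseteq> verts G"
    have s: "sepset G B A U' = sepset G A B (verts G - U')"
      using sepset_compl[OF G, of "verts G - U'" B A] U' by (simp add: double_diff)
    show "card (sepset G B A (verts G - U)) \<le> card (sepset G B A U')"
      using min[of "verts G - U'"] by (simp add: s sepset_compl[OF G U])
    assume "card (sepset G B A U') \<le> card (sepset G B A (verts G - U))"
    then show "card (crossed T X b a (verts G - U)) \<le> card (crossed T X b a U')"
      using min_crossed[of "verts G - U'"] cr[of "verts G - U'"] cr[of U] U U'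
      by (simp add: s sepset_compl[OF G U] double_diff)
  next
    show "card (sepset G B A (verts G - U)) < k" using small by (simp add: sepset_compl[OF G U])
    show "\<And>c. c \<in> between T b a \<Longrightarrow> k \<le> card (adh G T X c)"
      using large between_commute[OF T a b] by simp
  qed (use G T X a b A B in auto)
qed

text \<open>\<open>W\<close> lies within one side of \<open>b\<close>, whereas every edge of
  \<open>B\<close> crosses the cut belonging to \<open>b\<close>.\<close>

lemma no_B_inside:
  assumes W: "W \<in> sides T b" and e: "e \<in> B"
  shows "\<not> ends G e \<subseteq> XX W"
proof -
  obtain V where V: "V \<subseteq> verts T" "edge_cut T V = {b}" "W \<subseteq> V" using sides_subset[OF T W b] by blast
  have "e \<in> edge_cut G (XX V)" using adh_eq_cut[OF T X G V(1,2)] B(1) e by (auto simp: XX_def)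
  then have "\<not> ends G e \<subseteq> XX V" by (simp add: edge_cut_def)
  moreover have "XX W \<subseteq> XX V" using V(3) by (auto simp: XX_def)
  ultimately show ?thesis by blast
qed

lemma piece_le:
  assumes "W \<in> sides T b"
  shows "d (XX W \<inter> U) + card (sepset G A B (U \<union> XX W)) \<le> d (XX W) + card (sepset G A B U)"
    and "d (XX W \<inter> U) \<le> d (XX W)"
    and "d (XX W \<inter> U) = d (XX W) \<Longrightarrow> card (sepset G A B (U \<union> XX W)) \<le> card (sepset G A B U)"
proof -
  show *: "d (XX W \<inter> U) + card (sepset G A B (U \<union> XX W)) \<le> d (XX W) + card (sepset G A B U)"
    using no_B_inside[OF assms] by (intro sepset_uncross[OF G]) blast
  have "card (sepset G A B U) \<le> card (sepset G A B (U \<union> XX W))"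
    using U XX_verts[OF sidesD(1)[OF T assms]] by (intro min) blast
  then show "d (XX W \<inter> U) \<le> d (XX W)" using * by linarith
  show "d (XX W \<inter> U) = d (XX W) \<Longrightarrow> card (sepset G A B (U \<union> XX W)) \<le> card (sepset G A B U)"
    using * by linarith
qed

text \<open>Equality would make \<open>U \<union> XX W\<close> an equally small separator. It no
  longer crosses \<open>W\<close> and, by laminarity, crosses only sides that \<open>U\<close>
  crosses, against the second minimality condition.\<close>

lemma piece_crossed_less:
  assumes W: "W \<in> sides T a" "W \<in> sides T b" and cr: "XX W \<inter> U \<noteq> {}" "\<not> XX W \<subseteq> U"
  shows "d (XX W \<inter> U) < d (XX W)"
proof (rule ccontr)
  assume "\<not> ?thesis"
  then have "d (XX W \<inter> U) = d (XX W)" using piece_le(2)[OF W(2)] by simp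
  then have le: "card (sepset G A B (U \<union> XX W)) \<le> card (sepset G A B U)"
    by (rule piece_le(3)[OF W(2)])
  have sub: "W' \<in> crossed T X a b U" if W': "W' \<in> crossed T X a b (U \<union> XX W)" for W'
  proof -
    have s: "W' \<in> sides T a" "W' \<in> sides T b" and c: "XX W' \<inter> (U \<union> XX W) \<noteq> {}" "\<not> XX W' \<subseteq> U \<union> XX W"
      using W' by (auto simp: crossed_def XX_def)
    have "W' \<subseteq> W \<or> W \<subseteq> W' \<or> W' \<inter> W = {}" using sides_laminar[OF T s W a] .
    then have "XX W' \<inter> U \<noteq> {} \<and> \<not> XX W' \<subseteq> U"
    proof (elim disjE)
      assume "W' \<subseteq> W"
      then have "XX W' \<subseteq> XX W" by (auto simp: XX_def)
      then show ?thesis using c by blast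
    next
      assume "W \<subseteq> W'"
      then have "XX W \<subseteq> XX W'" by (auto simp: XX_def)
      then show ?thesis using c cr by blast
    next
      assume "W' \<inter> W = {}"
      then have "XX W' \<inter> XX W = {}"
        using XX_disjoint[OF sidesD(1)[OF T s(1)] sidesD(1)[OF T W(1)]] by blast
      then show ?thesis using c by blast
    qed
    then show ?thesis using s by (simp add: crossed_def XX_def)
  qed
  have "W \<in> crossed T X a b U" using W cr by (simp add: crossed_def XX_def)
  moreover have "W \<notin> crossed T X a b (U \<union> XX W)" by (auto simp: crossed_def XX_def)
  ultimately have "crossed T X a b (U \<union> XX W) \<subset> crossed T X a b U" using sub by blast
  moreover have "finite (crossed T X a b U)"
    using finite_sides[OF T, of a] by (simp add: crossed_def)
  ultimately have "card (crossed T X a b (U \<union> XX W)) < card (crossed T X a b U)"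
    by (simp add: psubset_card_mono)
  moreover have "U \<union> XX W \<subseteq> verts G" using U XX_verts[OF sidesD(1)[OF T W(1)]] by blast
  ultimately show False using min_crossed[OF _ le] by simp
qed

text \<open>Equality would make \<open>U \<union> XX W\<close> a separator with fewer than
  \<open>k\<close> edges. But every edge of \<open>B\<close> has an end in \<open>XX W\<close>, so
  that separator contains all \<open>k\<close> edges of \<open>B\<close>.\<close>

lemma piece_b_less:
  assumes W: "W \<in> sides T b" "edge_cut T W = {b}"
  shows "d (XX W \<inter> U) < d (XX W)"
proof (rule ccontr)
  assume "\<not> ?thesis"
  then have "d (XX W \<inter> U) = d (XX W)" using piece_le(2)[OF W(1)] by simp
  then have le: "card (sepset G A B (U \<union> XX W)) \<le> card (sepset G A B U)"
    by (rule piece_le(3)[OF W(1)])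
  have "B \<subseteq> edge_cut G (XX W)"
    using adh_eq_cut[OF T X G sidesD(1)[OF T W(1)] W(2)] B(1) by (simp add: XX_def)
  then have "B \<subseteq> sepset G A B (U \<union> XX W)" by (auto simp: edge_cut_def sepset_def)
  then have "k \<le> card (sepset G A B (U \<union> XX W))"
    using B(2) card_mono[OF finite_sepset[OF G]] by metis
  then show False using le small by simp
qed

lemma d_U: "d U < k"
proof -
  have "edge_cut G U \<subseteq> sepset G A B U" by (auto simp: sepset_def edge_cut_def)
  then show ?thesis using small card_mono[OF finite_sepset[OF G]] by (meson le_less_trans)
qed

text \<open>The new tree consists of two copies of \<open>T\<close>, named by truth values: copy \<open>True\<close> carries the
  part of \<open>G\<close> inside \<open>U\<close>, which contains what is left of \<open>A\<close>, and is therefore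
  split at the far link \<open>b\<close>; copy \<open>False\<close> is split at \<open>a\<close>.\<close>

definition split_link :: "bool \<Rightarrow> 'l" where "split_link c = (if c then b else a)"

definition part :: "bool \<Rightarrow> 'v set \<Rightarrow> 'v set" where "part c S = (if c then S \<inter> U else S - U)"

text \<open>There are three kinds of competing pieces. A second piece in copy \<open>True\<close>
  would be the other half of \<open>b\<close>, but halves of \<open>b\<close> lose adhesion
  strictly. In copy \<open>False\<close> with the same side, \<open>W\<close> is not crossed, so the
  competing piece has an empty cut. In copy \<open>False\<close> with the opposite side, the piece
  is the complement of \<open>XX W \<union> U\<close>, and submodularity bounds its cut by that of
  \<open>U\<close>.\<close>

lemma stable_True:
  assumes W: "W \<in> sides T b" and eq: "d (XX W \<inter> U) = d (XX W)"
    and W': "W' \<in> sides T (split_link c)" "edge_cut T W' = edge_cut T W" and ne: "c \<longrightarrow> W' \<noteq> W"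
  shows "d (part c (XX W')) < k"
proof -
  have WV: "W \<subseteq> verts T" using sidesD(1)[OF T W] .
  have nb: "edge_cut T W \<noteq> {b}" using piece_b_less[OF W] eq by auto
  show ?thesis
  proof (cases c)
    case True
    then show ?thesis using sides_unique[OF T W'(1)[unfolded split_link_def] _ W'(2)] W W' ne nb b
      by (auto simp: split_link_def)
  next
    case False
    then have W'a: "W' \<in> sides T a" using W'(1) by (simp add: split_link_def)
    have "W' = W \<or> W' = verts T - W" using sides_eq_or_compl[OF T W'(1) W W'(2)] .
    then show ?thesis
    proof
      assume [simp]: "W' = W"
      have "XX W \<inter> U = {} \<or> XX W \<subseteq> U" using piece_crossed_less[of W] W'a W eq by auto
      then have "d (XX W - U) = 0"
      proof
        assume 1: "XX W \<inter> U = {}"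
        then have "d (XX W) = 0" using eq by (simp add: edge_cut_def)
        moreover have "XX W - U = XX W" using 1 by blast
        ultimately show ?thesis by simp
      next
        assume "XX W \<subseteq> U"
        then have "XX W - U = {}" by blast
        then show ?thesis by (simp only: edge_cut_def) simp
      qed
      then show ?thesis using False small by (simp add: part_def)
    next
      assume "W' = verts T - W"
      then have "XX W' - U = verts G - (XX W \<union> U)" using XX_compl[OF WV] by auto
      then have "d (part c (XX W')) = d (XX W \<union> U)"
        using False edge_cut_compl[OF G, of "XX W \<union> U"] U XX_verts[OF WV] by (simp add: part_def)
      then show ?thesis using edge_cut_submodular[OF G, of "XX W" U] eq d_U by simp
    qed
  qed
qed

end

context violation
begin

text \<open>Copy \<open>False\<close> of this violation is copy \<open>True\<close> of the swapped
  one, so the statements proved for \<open>U\<close> and \<open>b\<close> can be reused for the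
  complement and \<open>a\<close>.\<close>

interpretation sw: violation G T X b a k B A "verts G - U"
  by (rule swap)

lemma part_swap: "W \<subseteq> verts T \<Longrightarrow> sw.part c (XX W) = part (\<not> c) (XX W)"
  using XX_verts[of W] by (auto simp: sw.part_def part_def)

lemma split_link_swap: "sw.split_link c = split_link (\<not> c)"
  by (simp add: sw.split_link_def split_link_def)

lemma part_le:
  assumes "W \<in> sides T (split_link c)"
  shows "d (part c (XX W)) \<le> d (XX W)"
proof (cases c)
  case True
  then show ?thesis using piece_le(2)[of W] assms by (simp add: part_def split_link_def)
next
  case False
  then have "W \<in> sides T a" using assms by (simp add: split_link_def)
  from sw.piece_le(2)[OF this] show ?thesis
    using part_swap[OF sidesD(1)[OF T assms], of True] False by (simp add: sw.part_def)
qed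

lemma part_split_less:
  assumes "W \<in> sides T (split_link c)" "edge_cut T W = {split_link c}"
  shows "d (part c (XX W)) < d (XX W)"
proof (cases c)
  case True
  then show ?thesis using piece_b_less[of W] assms by (simp add: part_def split_link_def)
next
  case False
  then have "W \<in> sides T a" "edge_cut T W = {a}" using assms by (simp_all add: split_link_def)
  from sw.piece_b_less[OF this] show ?thesis
    using part_swap[OF sidesD(1)[OF T assms(1)], of True] False by (simp add: sw.part_def)
qed

lemma stable_unique:
  assumes W: "W \<in> sides T (split_link c)" and eq: "d (part c (XX W)) = d (XX W)"
    and W': "W' \<in> sides T (split_link c')" "edge_cut T W' = edge_cut T W" and ne: "(c, W) \<noteq> (c', W')"
  shows "d (part c' (XX W')) < k"
proof (cases c)
  case True
  have "d (part c' (XX W')) < k"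
  proof (rule stable_True)
    show "W \<in> sides T b" "d (XX W \<inter> U) = d (XX W)"
      using W eq True by (simp_all add: part_def split_link_def)
  qed (use W' ne True in auto)
  then show ?thesis .
next
  case False
  have "d (sw.part (\<not> c') (XX W')) < k"
  proof (rule sw.stable_True)
    show "W \<in> sides T a" using W False by (simp add: split_link_def)
    show "d (XX W \<inter> (verts G - U)) = d (XX W)"
      using part_swap[OF sidesD(1)[OF T W], of True] False eq by (simp add: sw.part_def)
    show "W' \<in> sides T (sw.split_link (\<not> c'))" using W'(1) by (simp add: split_link_swap)
  qed (use W' ne False in auto)
  then show ?thesis using part_swap[OF sidesD(1)[OF T W'(1)], of "\<not> c'"] by simp
qed

end


section \<open>The improved decomposition\<close>

text \<open>Links are easier to follow than neighbours, because every link of the new tree has an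
  original; without parallel links both counts agree.\<close>

definition bold_links :: "('v, 'e) mgraph \<Rightarrow> ('t, 'l) mgraph \<Rightarrow> ('t \<Rightarrow> 'v set) \<Rightarrow> 't \<Rightarrow> 'l set" where
  "bold_links G T X t = {l \<in> edges T. t \<in> ends T l \<and> bold G T X l}"

text \<open>The diagonal pairs count the links of adhesion at least \<open>j\<close>; the others
  record which of them are connected through such links only.\<close>

definition linked_pairs ::
    "('v, 'e) mgraph \<Rightarrow> ('t, 'l) mgraph \<Rightarrow> ('t \<Rightarrow> 'v set) \<Rightarrow> nat \<Rightarrow> ('l \<times> 'l) set" where
  "linked_pairs G T X j =
     {(e, g) \<in> edges T \<times> edges T. \<forall>c\<in>between T e g. j \<le> card (adh G T X c)}"

lemma cut_tree_no_parallel: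
  assumes T: "cut_tree T" and lm: "l \<in> edges T" "m \<in> edges T" "ends T l = ends T m"
  shows "l = m"
proof -
  have "\<exists>W\<subseteq>verts T. edge_cut T W = {l}" using T lm(1) by (simp add: cut_tree_def)
  then obtain W where W: "edge_cut T W = {l}" by blast
  then have "l \<in> edge_cut T W" by simp
  then have "m \<in> edge_cut T W" using lm by (simp add: edge_cut_def)
  then show ?thesis using W by simp
qed

lemma card_bold_nbrs:
  assumes T: "cut_tree T"
  shows "card (bold_nbrs G T X t) = card (bold_links G T X t)"
proof -
  define f where "f l = the_elem (ends T l - {t})" for l
  have f: "ends T l = {t, f l} \<and> f l \<noteq> t \<and> f l \<in> verts T" if l: "l \<in> edges T" "t \<in> ends T l" for l
  proof -
    obtain x y where xy: "ends T l = {x, y}" "x \<noteq> y" "x \<in> verts T" "y \<in> verts T"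
      using fin_multigraph_endsE[OF cut_tree_fin[OF T] l(1)] .
    then have "t = x \<or> t = y" using l by auto
    then show ?thesis
    proof
      assume "t = x"
      then have "ends T l - {t} = {y}" using xy by auto
      then show ?thesis using xy \<open>t = x\<close> by (simp add: f_def)
    next
      assume "t = y"
      then have "ends T l - {t} = {x}" using xy by auto
      then show ?thesis using xy \<open>t = y\<close> by (simp add: f_def insert_commute)
    qed
  qed
  have "inj_on f (bold_links G T X t)"
  proof (rule inj_onI)
    fix l m assume "l \<in> bold_links G T X t" "m \<in> bold_links G T X t" "f l = f m"
    then show "l = m"
      using f[of l] f[of m] cut_tree_no_parallel[OF T, of l m] by (simp add: bold_links_def)
  qed
  moreover have "f ` bold_links G T X t = bold_nbrs G T X t"
  proof (intro equalityI subsetI)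
    fix s assume "s \<in> f ` bold_links G T X t"
    then show "s \<in> bold_nbrs G T X t" using f unfolding bold_links_def bold_nbrs_def by blast
  next
    fix s assume "s \<in> bold_nbrs G T X t"
    then obtain l where l: "l \<in> edges T" "ends T l = {t, s}" "bold G T X l"
      by (auto simp: bold_nbrs_def)
    then have "l \<in> bold_links G T X t" by (simp add: bold_links_def)
    moreover have "f l = s" using f[of l] l by (auto simp: doubleton_eq_iff)
    ultimately show "s \<in> f ` bold_links G T X t" by blast
  qed
  ultimately show ?thesis using card_image by fastforce
qed

lemma decomp_width_le_iff:
  assumes T: "cut_tree T"
  shows "decomp_width G T X \<le> w \<longleftrightarrow> (\<forall>l\<in>edges T. card (adh G T X l) \<le> w) \<and>
    (\<forall>t\<in>verts T. card (X t) + card (bold_links G T X t) \<le> w)"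
proof -
  have "finite (edges T)" "finite (verts T)" "verts T \<noteq> {}"
    using T by (auto simp: cut_tree_def fin_multigraph_def)
  then show ?thesis unfolding decomp_width_def card_bold_nbrs[OF T] by (subst Max_le_iff) auto
qed

context violation
begin

section \<open>The new tree\<close>

definition lk :: "'t set \<Rightarrow> 'l" where "lk W = the_elem (edge_cut T W)"

text \<open>The node \<open>(c, None)\<close> subdivides \<open>split_link c\<close>, and the link \<open>None\<close> joins these two
  nodes. Every other link is named by its copy and by its side away from \<open>(c, None)\<close>, so
  that the two halves of \<open>split_link c\<close> are named by the two sides of that link.\<close>

definition newT :: "(bool \<times> 't option, (bool \<times> 't set) option) mgraph" where
  "newT = \<lparr>verts = UNIV \<times> insert None (Some ` verts T),
     edges = insert None (Some ` (SIGMA c:UNIV. sides T (split_link c))),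
     ends = (\<lambda>l. case l of None \<Rightarrow> {(True, None), (False, None)}
       | Some (c, W) \<Rightarrow> Pair c ` (Some ` (ends T (lk W) \<inter> W) \<union>
           (if lk W = split_link c then {None} else Some ` (ends T (lk W) - W))))\<rparr>"

definition newX :: "bool \<times> 't option \<Rightarrow> 'v set" where
  "newX n = (case snd n of None \<Rightarrow> {} | Some t \<Rightarrow> part (fst n) (X t))"

definition lift :: "bool \<Rightarrow> 't set \<Rightarrow> (bool \<times> 't option) set" where
  "lift c W = (\<lambda>t. (c, Some t)) ` W"

definition half :: "bool \<Rightarrow> (bool \<times> 't option) set" where
  "half c = {c} \<times> insert None (Some ` verts T)"

lemma lift_iff [simp]: "(c', n) \<in> lift c W \<longleftrightarrow> c' = c \<and> (\<exists>t\<in>W. n = Some t)"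
  by (auto simp: lift_def)

lemma split_link_edges: "split_link c \<in> edges T"
  using a b by (simp add: split_link_def)

lemma edge_cut_lk: "W \<in> sides T c \<Longrightarrow> edge_cut T W = {lk W}"
  using sidesD(2)[OF T] by (fastforce simp: lk_def)

lemma lk_edges: "W \<in> sides T c \<Longrightarrow> lk W \<in> edges T"
  using edge_cut_lk by (fastforce simp: edge_cut_def)

lemma adh_lk: "W \<in> sides T c \<Longrightarrow> card (adh G T X (lk W)) = d (XX W)"
  using adh_d[OF sidesD(1)[OF T] edge_cut_lk] .

lemma newT_edges: "l \<in> edges newT \<longleftrightarrow> l = None \<or> (\<exists>c W. l = Some (c, W) \<and> W \<in> sides T (split_link c))"
  by (auto simp: newT_def)

lemma newT_verts: "(c, n) \<in> verts newT \<longleftrightarrow> n = None \<or> (\<exists>t\<in>verts T. n = Some t)"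
  by (auto simp: newT_def)

lemma lift_verts: "W \<subseteq> verts T \<Longrightarrow> lift c W \<subseteq> verts newT"
  by (auto simp: newT_verts subset_iff)

lemma ends_None: "ends newT None = {(True, None), (False, None)}"
  by (simp add: newT_def)

lemma ends_SomeE:
  assumes W: "W \<in> sides T c'"
  obtains x y where "ends T (lk W) = {x, y}" "x \<in> W" "y \<in> verts T - W"
    "ends newT (Some (c, W)) = {(c, Some x), (c, if lk W = split_link c then None else Some y)}"
proof -
  obtain x y where xy: "ends T (lk W) = {x, y}" "x \<in> W" "y \<in> verts T - W"
    using cut_tree_endsE[OF T edge_cut_lk[OF W] sidesD(1)[OF T W]] .
  then have "ends T (lk W) \<inter> W = {x}" "ends T (lk W) - W = {y}" by auto
  then have "ends newT (Some (c, W)) = {(c, Some x), (c, if lk W = split_link c then None else Some y)}"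
    by (auto simp: newT_def)
  then show ?thesis using that xy by blast
qed

lemma fin_multigraph_newT: "fin_multigraph newT"
proof -
  have "finite (verts newT)"
    using cut_tree_fin[OF T] by (simp add: newT_def fin_multigraph_def finite_cartesian_product)
  moreover have "finite (edges newT)"
    using finite_sides[OF T] by (simp add: newT_def finite_SigmaI)
  moreover have "ends newT l \<subseteq> verts newT \<and> card (ends newT l) = 2" if l: "l \<in> edges newT" for l
  proof (cases l)
    case None
    then show ?thesis by (simp add: ends_None newT_verts)
  next
    case (Some p)
    then obtain c W where l': "l = Some (c, W)" "W \<in> sides T (split_link c)"
      using l by (auto simp: newT_edges)
    obtain x y where xy: "x \<in> W" "y \<in> verts T - W"
      "ends newT (Some (c, W)) = {(c, Some x), (c, if lk W = split_link c then None else Some y)}"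
      using ends_SomeE[OF l'(2)] by metis
    have "x \<in> verts T" using xy sidesD(1)[OF T l'(2)] by blast
    moreover have "Some x \<noteq> (if lk W = split_link c then None else Some y)" using xy by auto
    ultimately show ?thesis using xy l' by (auto simp: newT_verts)
  qed
  ultimately show ?thesis by (simp add: fin_multigraph_def)
qed

text \<open>\<open>lift c W\<close> avoids the subdividing node, so a crossing link comes from a
  link of \<open>T\<close> that crosses \<open>W\<close>, and a side determines its name in copy
  \<open>c\<close>.\<close>

lemma edge_cut_lift:
  assumes W: "W \<in> sides T (split_link c)"
  shows "edge_cut newT (lift c W) = {Some (c, W)}"
proof -
  have "l \<in> edge_cut newT (lift c W) \<longleftrightarrow> l = Some (c, W)" for l
  proof (cases "l \<in> edges newT \<and> l \<noteq> None")
    case False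
    then have "l \<noteq> Some (c, W)" using W by (auto simp: newT_edges)
    moreover have "l \<notin> edge_cut newT (lift c W)"
      using False by (cases l) (auto simp: edge_cut_def ends_None)
    ultimately show ?thesis by blast
  next
    case True
    then obtain c' V where l: "l = Some (c', V)" and V: "V \<in> sides T (split_link c')"
      by (auto simp: newT_edges)
    obtain x y where xy: "ends T (lk V) = {x, y}" "x \<in> V" "y \<in> verts T - V" and
      e: "ends newT (Some (c', V)) = {(c', Some x), (c', if lk V = split_link c' then None else Some y)}"
      using ends_SomeE[OF V] .
    have cross: "l \<in> edge_cut newT (lift c W) \<longleftrightarrow>
      c' = c \<and> (x \<in> W \<longleftrightarrow> \<not> (lk V \<noteq> split_link c \<and> y \<in> W))"
      using True unfolding l edge_cut_iff[OF e] by auto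
    show ?thesis
    proof
      assume "l = Some (c, W)"
      then show "l \<in> edge_cut newT (lift c W)" using cross l xy by auto
    next
      assume "l \<in> edge_cut newT (lift c W)"
      then have c': "c' = c" and x: "x \<in> W \<longleftrightarrow> \<not> (lk V \<noteq> split_link c \<and> y \<in> W)" using cross by auto
      have V': "V \<in> sides T (split_link c)" using V c' by simp
      have "V = W"
      proof (cases "lk V = split_link c")
        case False
        then have "lk V \<in> edge_cut T W" using x lk_edges[OF V] edge_cut_iff[OF xy(1)] by auto
        then have "edge_cut T V = edge_cut T W" using edge_cut_lk[OF V] edge_cut_lk[OF W] by simp
        moreover have "edge_cut T V \<noteq> {split_link c}" using edge_cut_lk[OF V] False by simp
        ultimately show ?thesis by (rule sides_unique[OF T V' W _ _ split_link_edges])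
      next
        \<comment> \<open>The two halves of the split link have the same \<open>lk\<close>; the half
          whose original end lies in \<open>W\<close> is the one that crosses.\<close>
        case True
        then have xW: "x \<in> W" using x by blast
        have "\<not> ends T (lk V) \<subseteq> W" using sidesD(3)[OF T W] True by simp
        then have "lk V \<in> edge_cut T W" using xW xy lk_edges[OF V] by (auto simp: edge_cut_def)
        then have "edge_cut T V = edge_cut T W" using edge_cut_lk[OF V] edge_cut_lk[OF W] by simp
        then have "V = W \<or> V = verts T - W" by (rule sides_eq_or_compl[OF T V W])
        then show ?thesis using xW xy by auto
      qed
      then show "l = Some (c, W)" using l c' by simp
    qed
  qed
  then show ?thesis by blast
qed

lemma edge_cut_half: "edge_cut newT (half c) = {None}"
proof -
  have "l \<in> edge_cut newT (half c) \<longleftrightarrow> l = None" for l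
  proof (cases "l \<in> edges newT \<and> l \<noteq> None")
    case False
    then show ?thesis by (cases c) (auto simp: edge_cut_def newT_edges ends_None half_def)
  next
    case True
    then obtain c' V where l: "l = Some (c', V)" and V: "V \<in> sides T (split_link c')"
      by (auto simp: newT_edges)
    obtain x y where xy: "ends T (lk V) = {x, y}" "x \<in> V" "y \<in> verts T - V" and
      e: "ends newT (Some (c', V)) = {(c', Some x), (c', if lk V = split_link c' then None else Some y)}"
      using ends_SomeE[OF V] .
    have "x \<in> verts T" "y \<in> verts T" using xy sidesD(1)[OF T V] by auto
    then show ?thesis unfolding l edge_cut_iff[OF e] by (auto simp: half_def)
  qed
  then show ?thesis by blast
qed

text \<open>A set with empty cut that misses the subdividing node of a copy misses that whole copy.
  This is applied to \<open>S\<close> or to its complement, since the link \<open>None\<close> puts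
  both subdividing nodes on the same side.\<close>

lemma newT_connected:
  assumes S: "S \<subseteq> verts newT" and cut: "edge_cut newT S = {}"
  shows "S = {} \<or> S = verts newT"
proof -
  have empty: "t \<notin> verts T \<or> (c, Some t) \<notin> R"
    if R: "R \<subseteq> verts newT" "edge_cut newT R = {}" "(c, None) \<notin> R" for c t R
  proof (rule ccontr)
    assume t: "\<not> (t \<notin> verts T \<or> (c, Some t) \<notin> R)"
    let ?W = "{t \<in> verts T. (c, Some t) \<in> R}"
    \<comment> \<open>Each end of the split link is joined to \<open>(c, None)\<close> by the half
      named after the side containing that end.\<close>
    have no_split: "x \<notin> ?W" if x: "x \<in> ends T (split_link c)" for x
    proof -
      have "\<exists>W\<in>sides T (split_link c). edge_cut T W = {split_link c}"
        by (rule sides_exists[OF T split_link_edges split_link_edges])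
      then obtain V where V: "V \<subseteq> verts T" "edge_cut T V = {split_link c}"
        using sidesD(1)[OF T] by blast
      let ?V = "if x \<in> V then V else verts T - V"
      have xT: "x \<in> verts T"
        using x fin_multigraph_ends(1)[OF cut_tree_fin[OF T] split_link_edges] by blast
      have "edge_cut T ?V = {split_link c}" "?V \<subseteq> verts T" "x \<in> ?V"
        using V edge_cut_compl[OF cut_tree_fin[OF T] V(1)] xT by auto
      then obtain V where V: "edge_cut T V = {split_link c}" "V \<subseteq> verts T" "x \<in> V" by blast
      then have sV: "V \<in> sides T (split_link c)" by (auto simp: sides_def edge_cut_def)
      have lkV: "lk V = split_link c" using edge_cut_lk[OF sV] V(1) by simp
      obtain x' y where xy: "ends T (lk V) = {x', y}" "x' \<in> V" "y \<in> verts T - V"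
        and e: "ends newT (Some (c, V)) = {(c, Some x'), (c, if lk V = split_link c then None else Some y)}"
        using ends_SomeE[OF sV] .
      have "x' = x" using xy V(3) x lkV by auto
      have "Some (c, V) \<notin> edge_cut newT R" "Some (c, V) \<in> edges newT"
        using R(2) sV by (auto simp: newT_edges)
      then have "(c, Some x) \<notin> R" unfolding edge_cut_iff[OF e] using R(3) lkV \<open>x' = x\<close> by simp
      then show ?thesis by blast
    qed
    have "edge_cut T ?W = {}"
    proof (rule ccontr)
      assume "edge_cut T ?W \<noteq> {}"
      then obtain l where l: "l \<in> edge_cut T ?W" by blast
      then have lE: "l \<in> edges T" and "l \<noteq> split_link c" using no_split by (auto simp: edge_cut_def)
      obtain V where V: "V \<in> sides T (split_link c)" "edge_cut T V = {l}"
        using sides_exists[OF T lE split_link_edges] by blast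
      have lkV: "lk V = l" using edge_cut_lk[OF V(1)] V(2) by simp
      obtain x y where xy: "ends T (lk V) = {x, y}" "x \<in> V" "y \<in> verts T - V"
        and e: "ends newT (Some (c, V)) = {(c, Some x), (c, if lk V = split_link c then None else Some y)}"
        using ends_SomeE[OF V(1)] .
      have "x \<in> verts T" "y \<in> verts T" using xy sidesD(1)[OF T V(1)] by auto
      then have "(c, Some x) \<in> R \<longleftrightarrow> (c, Some y) \<notin> R"
        using l xy(1) unfolding lkV by (simp add: edge_cut_iff)
      moreover have "Some (c, V) \<notin> edge_cut newT R" "Some (c, V) \<in> edges newT"
        using R(2) V by (auto simp: newT_edges)
      ultimately show False unfolding edge_cut_iff[OF e] using lkV \<open>l \<noteq> split_link c\<close> by simp
    qed
    then have "?W = {} \<or> ?W = verts T" by (intro cut_tree_trivial[OF T]) auto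
    then have "?W = verts T" using t by blast
    moreover obtain x where "x \<in> ends T (split_link c)"
      using fin_multigraph_ends(2)[OF cut_tree_fin[OF T] split_link_edges, of c] by fastforce
    ultimately show False
      using no_split fin_multigraph_ends(1)[OF cut_tree_fin[OF T] split_link_edges, of c] by blast
  qed
  have "None \<notin> edge_cut newT S" "None \<in> edges newT" using cut by (auto simp: newT_edges)
  then have mid: "(True, None) \<in> S \<longleftrightarrow> (False, None) \<in> S"
    unfolding edge_cut_iff[OF ends_None] by blast
  show ?thesis
  proof (cases "(True, None) \<in> S")
    case False
    then have "(c, None) \<notin> S" for c using mid by (cases c) auto
    then have "(c, n) \<notin> S" for c n using empty[OF S cut] S by (cases n) (auto simp: newT_verts)
    then show ?thesis by auto
  next
    case True
    let ?S = "verts newT - S"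
    have S': "?S \<subseteq> verts newT" "edge_cut newT ?S = {}"
      using edge_cut_compl[OF fin_multigraph_newT S] cut by auto
    have "(c, None) \<notin> ?S" for c using mid True by (cases c) auto
    then have "(c, n) \<notin> ?S" for c n using empty[OF S', of c] newT_verts[of c n] by (cases n) auto
    then have "?S = {}" by auto
    then show ?thesis using S by blast
  qed
qed

lemma cut_tree_newT: "cut_tree newT"
proof -
  have "\<exists>W\<subseteq>verts newT. edge_cut newT W = {l}" if l: "l \<in> edges newT" for l
  proof (cases l)
    case None
    have "half True \<subseteq> verts newT" by (auto simp: half_def newT_verts)
    then show ?thesis using edge_cut_half None by blast
  next
    case (Some p)
    then obtain c W where l': "l = Some (c, W)" "W \<in> sides T (split_link c)"
      using l by (auto simp: newT_edges)
    have "lift c W \<subseteq> verts newT" using lift_verts[OF sidesD(1)[OF T l'(2)]] .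
    then show ?thesis using edge_cut_lift l' by blast
  qed
  moreover have "verts newT \<noteq> {}" using newT_verts by blast
  ultimately show ?thesis using fin_multigraph_newT newT_connected unfolding cut_tree_def by blast
qed

section \<open>Bags and adhesions of the new decomposition\<close>

lemma newX_disjoint: "disjoint_family_on newX (verts newT)"
  unfolding disjoint_family_on_def
proof (intro ballI impI)
  fix p q assume pq: "p \<in> verts newT" "q \<in> verts newT" "p \<noteq> q"
  show "newX p \<inter> newX q = {}"
  proof (cases "snd p = None \<or> snd q = None")
    case True
    then show ?thesis by (auto simp: newX_def)
  next
    case False
    then obtain c t c' t' where p: "p = (c, Some t)" and q: "q = (c', Some t')"
      by (cases p; cases q) auto
    have "t \<in> verts T" "t' \<in> verts T" using pq p q by (auto simp: newT_verts)
    then have "t = t' \<or> X t \<inter> X t' = {}" using X(1) by (auto simp: disjoint_family_on_def)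
    then show ?thesis using pq p q by (auto simp: newX_def part_def)
  qed
qed

lemma newX_lift: "(\<Union>p\<in>lift c W. newX p) = part c (XX W)"
  by (auto simp: lift_def newX_def part_def XX_def)

lemma newX_half: "(\<Union>p\<in>half c. newX p) = part c (verts G)"
proof -
  have "(\<Union>p\<in>half c. newX p) = (\<Union>t\<in>verts T. part c (X t))" by (auto simp: half_def newX_def)
  also have "\<dots> = part c (\<Union>t\<in>verts T. X t)" by (auto simp: part_def)
  finally show ?thesis by (simp only: X(2))
qed

lemma newX_verts: "(\<Union>p\<in>verts newT. newX p) = verts G"
proof -
  have "verts newT = half True \<union> half False" by (auto simp: half_def newT_def)
  then have "(\<Union>p\<in>verts newT. newX p) = part True (verts G) \<union> part False (verts G)"
    by (simp add: newX_half UN_Un)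
  then show ?thesis by (auto simp: part_def)
qed

lemma adh_new_Some:
  assumes W: "W \<in> sides T (split_link c)"
  shows "card (adh G newT newX (Some (c, W))) = d (part c (XX W))"
proof -
  have "lift c W \<subseteq> verts newT" using lift_verts[OF sidesD(1)[OF T W]] .
  then show ?thesis
    using adh_eq_cut[OF cut_tree_newT newX_disjoint newX_verts G _ edge_cut_lift[OF W]]
    by (simp add: newX_lift)
qed

lemma adh_new_None: "card (adh G newT newX None) = d U"
proof -
  have "half True \<subseteq> verts newT" by (auto simp: half_def newT_verts)
  moreover have "part True (verts G) = U" using U by (auto simp: part_def)
  ultimately show ?thesis
    using adh_eq_cut[OF cut_tree_newT newX_disjoint newX_verts G _ edge_cut_half[of True]]
    by (simp add: newX_half)
qed

lemma adh_new_le: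
  assumes W: "W \<in> sides T (split_link c)"
  shows "card (adh G newT newX (Some (c, W))) \<le> card (adh G T X (lk W))"
  unfolding adh_new_Some[OF W] adh_lk[OF W] by (rule part_le[OF W])

section \<open>Linked pairs before and after the construction\<close>

lemma k_le_a: "k \<le> card (adh G T X a)"
  using large between_self[OF T a b] by blast

text \<open>Used to bound the adhesion of \<open>e\<close> from below by that of a piece between the
  two new links. Because \<open>e\<close> differs from both originals, these lie entirely on
  opposite sides of \<open>e\<close>, so either choice of side for the piece separates their
  copies.\<close>

lemma between_newT:
  assumes W: "W \<in> sides T (split_link c)" "W' \<in> sides T (split_link c)"
    and e: "e \<in> between T (lk W) (lk W')" "e \<noteq> lk W" "e \<noteq> lk W'"
  shows "\<exists>V\<in>sides T (split_link c). lk V = e \<and> Some (c, V) \<in> between newT (Some (c, W)) (Some (c, W'))"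
proof -
  obtain V where V: "V \<subseteq> verts T" "edge_cut T V = {e}" "ends T (lk W) \<inter> V \<noteq> {}" "\<not> ends T (lk W') \<subseteq> V"
    using e(1) unfolding between_def[OF T] by blast
  have in_out: "ends T (lk W) \<subseteq> V" "ends T (lk W') \<inter> V = {}"
    using not_crossing_ends[OF T V(2) lk_edges[OF W(1)]] not_crossing_ends[OF T V(2) lk_edges[OF W(2)]] V(3,4) e
    by blast+
  obtain x where x: "x \<in> ends T (lk W)" "(c, Some x) \<in> ends newT (Some (c, W))"
    by (rule ends_SomeE[OF W(1), of c]) auto
  obtain x' where x': "x' \<in> ends T (lk W')" "(c, Some x') \<in> ends newT (Some (c, W'))"
    by (rule ends_SomeE[OF W(2), of c]) auto
  have V': "edge_cut T (verts T - V) = {e}"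
    using edge_cut_compl[OF cut_tree_fin[OF T] V(1)] V(2) by simp
  have xV: "x \<in> V" "x' \<in> verts T - V"
    using in_out x x' fin_multigraph_ends(1)[OF cut_tree_fin[OF T] lk_edges[OF W(2)]] by blast+
  have E: "Some (c, W) \<in> edges newT" "Some (c, W') \<in> edges newT" using W by (auto simp: newT_edges)
  have "ends T (split_link c) \<noteq> {}"
    using fin_multigraph_ends(2)[OF cut_tree_fin[OF T] split_link_edges, of c] by fastforce
  then have "\<not> ends T (split_link c) \<subseteq> V \<or> \<not> ends T (split_link c) \<subseteq> verts T - V" by blast
  then show ?thesis
  proof
    assume "\<not> ends T (split_link c) \<subseteq> V"
    then have s: "V \<in> sides T (split_link c)" using V by (auto simp: sides_def)
    have "lift c V \<subseteq> verts newT" using lift_verts[OF V(1)] .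
    moreover have "ends newT (Some (c, W)) \<inter> lift c V \<noteq> {}" using x(2) xV by auto
    moreover have "\<not> ends newT (Some (c, W')) \<subseteq> lift c V" using x'(2) xV by auto
    ultimately have "Some (c, V) \<in> between newT (Some (c, W)) (Some (c, W'))"
      using edge_cut_lift[OF s] unfolding between_def[OF cut_tree_newT] by blast
    moreover have "lk V = e" using edge_cut_lk[OF s] V(2) by simp
    ultimately show ?thesis using s by blast
  next
    let ?V = "verts T - V"
    assume "\<not> ends T (split_link c) \<subseteq> ?V"
    then have s: "?V \<in> sides T (split_link c)" using V' by (auto simp: sides_def)
    have "lift c ?V \<subseteq> verts newT" by (rule lift_verts) blast
    moreover have "ends newT (Some (c, W')) \<inter> lift c ?V \<noteq> {}" using x'(2) xV by auto
    moreover have "\<not> ends newT (Some (c, W)) \<subseteq> lift c ?V" using x(2) xV by auto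
    ultimately have "Some (c, ?V) \<in> between newT (Some (c, W')) (Some (c, W))"
      using edge_cut_lift[OF s] unfolding between_def[OF cut_tree_newT] by blast
    moreover have "lk ?V = e" using edge_cut_lk[OF s] V' by simp
    ultimately show ?thesis using s between_commute[OF cut_tree_newT E] by blast
  qed
qed

text \<open>The link \<open>None\<close> has adhesion \<open>d U\<close>, less than \<open>k\<close>
  and hence less than \<open>j\<close>. So it is neither member of the pair nor between them, which
  forces both into one copy; there every separating link of \<open>T\<close> has at least the
  adhesion of one of its pieces.\<close>

lemma linked_pairs_newTD:
  assumes kj: "k \<le> j" and xy: "(x, y) \<in> linked_pairs G newT newX j"
  obtains c W W' where "x = Some (c, W)" "y = Some (c, W')"
    "W \<in> sides T (split_link c)" "W' \<in> sides T (split_link c)"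
    "j \<le> d (part c (XX W))" "j \<le> d (part c (XX W'))"
    "(lk W, lk W') \<in> linked_pairs G T X j"
proof -
  have E: "x \<in> edges newT" "y \<in> edges newT"
    and ge: "\<And>z. z \<in> between newT x y \<Longrightarrow> j \<le> card (adh G newT newX z)"
    using xy by (auto simp: linked_pairs_def)
  have xy_ge: "j \<le> card (adh G newT newX x)" "j \<le> card (adh G newT newX y)"
    using ge between_self[OF cut_tree_newT E] by auto
  have "x \<noteq> None"
  proof
    assume "x = None"
    then show False using xy_ge(1) adh_new_None d_U kj by simp
  qed
  moreover have "y \<noteq> None"
  proof
    assume "y = None"
    then show False using xy_ge(2) adh_new_None d_U kj by simp
  qed
  ultimately obtain c W c' W' where x: "x = Some (c, W)" "W \<in> sides T (split_link c)"
    and y: "y = Some (c', W')" "W' \<in> sides T (split_link c')"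
    using E by (auto simp: newT_edges)
  have "c' = c"
  proof (rule ccontr)
    assume "c' \<noteq> c"
    obtain p where p: "(c, Some p) \<in> ends newT x"
      unfolding x(1) by (rule ends_SomeE[OF x(2), of c]) blast
    obtain q where q: "(c', Some q) \<in> ends newT y"
      unfolding y(1) by (rule ends_SomeE[OF y(2), of c']) blast
    have "ends newT x \<subseteq> verts newT" using fin_multigraph_ends(1)[OF fin_multigraph_newT E(1)] .
    then have "(c, Some p) \<in> half c" using p by (auto simp: half_def newT_verts)
    then have "ends newT x \<inter> half c \<noteq> {}" using p by blast
    moreover have "\<not> ends newT y \<subseteq> half c" using q \<open>c' \<noteq> c\<close> by (auto simp: half_def)
    moreover have "half c \<subseteq> verts newT" by (auto simp: half_def newT_verts)
    ultimately have "None \<in> between newT x y"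
      using edge_cut_half unfolding between_def[OF cut_tree_newT] by blast
    then show False using ge adh_new_None d_U kj by fastforce
  qed
  have le: "j \<le> d (part c (XX W))" "j \<le> d (part c (XX W'))"
    using xy_ge adh_new_Some x y \<open>c' = c\<close> by auto
  have y': "W' \<in> sides T (split_link c)" using y \<open>c' = c\<close> by simp
  have "j \<le> card (adh G T X e)" if e: "e \<in> between T (lk W) (lk W')" for e
  proof (cases "e = lk W \<or> e = lk W'")
    case True
    then show ?thesis using le part_le[OF x(2)] part_le[OF y'] adh_lk[OF x(2)] adh_lk[OF y'] by auto
  next
    case False
    then obtain V where V: "V \<in> sides T (split_link c)" "lk V = e" "Some (c, V) \<in> between newT x y"
      using between_newT[OF x(2) y' e] x y \<open>c' = c\<close> by auto
    then show ?thesis using ge[OF V(3)] adh_new_le[OF V(1)] by simp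
  qed
  then have "(lk W, lk W') \<in> linked_pairs G T X j"
    using lk_edges[OF x(2)] lk_edges[OF y'] by (simp add: linked_pairs_def)
  then show ?thesis using that x y y' le \<open>c' = c\<close> by blast
qed

text \<open>By \<open>stable_unique\<close>, from \<open>threshold\<close> upwards the links of the new tree correspond to
  distinct stable links of \<open>T\<close>.\<close>

definition stable :: "'l \<Rightarrow> bool" where
  "stable e \<longleftrightarrow> (\<exists>c W. W \<in> sides T (split_link c) \<and> lk W = e \<and> d (part c (XX W)) = d (XX W))"

text \<open>The largest adhesion of an unstable link, as far as it is at least \<open>k\<close>,
  with default \<open>k\<close>. It is chosen as the level at which something is certainly lost,
  while nothing is gained there or above.\<close>

definition threshold :: nat where
  "threshold = Max (insert k ((\<lambda>e. card (adh G T X e)) ` {e \<in> edges T. k \<le> card (adh G T X e) \<and> \<not> stable e}))"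

lemma finite_edges_T: "finite (edges T)"
  using cut_tree_fin[OF T] by (simp add: fin_multigraph_def)

lemma threshold_ge: "k \<le> threshold"
  "e \<in> edges T \<Longrightarrow> k \<le> card (adh G T X e) \<Longrightarrow> \<not> stable e \<Longrightarrow> card (adh G T X e) \<le> threshold"
  unfolding threshold_def using finite_edges_T by (auto intro!: Max_ge)

text \<open>If the original link is stable, uniqueness makes this piece the stable one. Otherwise
  its adhesion is at most \<open>threshold\<close>, hence at most that of the piece.\<close>

lemma large_piece_stable:
  assumes W: "W \<in> sides T (split_link c)" and j: "threshold \<le> j" "j \<le> d (part c (XX W))"
  shows "d (part c (XX W)) = d (XX W)"
proof (cases "stable (lk W)")
  case False
  have "k \<le> card (adh G T X (lk W))" using j threshold_ge(1) part_le[OF W] adh_lk[OF W] by linarith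
  then have "d (XX W) \<le> threshold"
    using threshold_ge(2)[OF lk_edges[OF W] _ False] adh_lk[OF W] by simp
  then show ?thesis using j part_le[OF W] by linarith
next
  case True
  then obtain c' W' where W': "W' \<in> sides T (split_link c')" "lk W' = lk W" "d (part c' (XX W')) = d (XX W')"
    by (auto simp: stable_def)
  have "(c', W') = (c, W)"
  proof (rule ccontr)
    assume "(c', W') \<noteq> (c, W)"
    then have "d (part c (XX W)) < k"
      using stable_unique[OF W'(1,3) W] edge_cut_lk[OF W] edge_cut_lk[OF W'(1)] W'(2) by simp
    then show False using j threshold_ge(1) by linarith
  qed
  then show ?thesis using W'(3) by simp
qed

text \<open>The value at \<open>None\<close> does not matter: that link occurs in no linked pair
  from level \<open>k\<close> upwards and is not incident with any node
  \<open>(c, Some t)\<close>.\<close>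

definition link_of :: "(bool \<times> 't set) option \<Rightarrow> 'l" where
  "link_of x = lk (snd (the x))"

lemma linked_pairs_image:
  assumes j: "threshold \<le> j"
  shows "map_prod link_of link_of ` linked_pairs G newT newX j \<subseteq> linked_pairs G T X j"
proof -
  have kj: "k \<le> j" using threshold_ge(1) j by simp
  show ?thesis
  proof
    fix z assume "z \<in> map_prod link_of link_of ` linked_pairs G newT newX j"
    then obtain x y where xy: "(x, y) \<in> linked_pairs G newT newX j" "z = (link_of x, link_of y)"
      by auto
    show "z \<in> linked_pairs G T X j"
      by (rule linked_pairs_newTD[OF kj xy(1)]) (simp add: xy(2) link_of_def)
  qed
qed

lemma linked_pairs_inj:
  assumes j: "threshold \<le> j"
  shows "inj_on (map_prod link_of link_of) (linked_pairs G newT newX j)"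
proof (rule inj_onI)
  have kj: "k \<le> j" using threshold_ge(1) j by simp
  have eq: "(c, W) = (c', W')"
    if W: "W \<in> sides T (split_link c)" "j \<le> d (part c (XX W))"
      and W': "W' \<in> sides T (split_link c')" "j \<le> d (part c' (XX W'))" and lk: "lk W = lk W'"
    for c c' W W'
  proof (rule ccontr)
    assume ne: "(c, W) \<noteq> (c', W')"
    have "d (part c' (XX W')) < k"
      using stable_unique[OF W(1) large_piece_stable[OF W(1) j W(2)] W'(1) _ ne]
        edge_cut_lk[OF W(1)] edge_cut_lk[OF W'(1)] lk by simp
    then show False using W'(2) kj by simp
  qed
  fix p q assume p: "p \<in> linked_pairs G newT newX j" and q: "q \<in> linked_pairs G newT newX j"
    and pq: "map_prod link_of link_of p = map_prod link_of link_of q"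
  obtain c W W' where 1: "p = (Some (c, W), Some (c, W'))"
    "W \<in> sides T (split_link c)" "W' \<in> sides T (split_link c)"
    "j \<le> d (part c (XX W))" "j \<le> d (part c (XX W'))"
    using linked_pairs_newTD[OF kj, of "fst p" "snd p"] p by (metis prod.collapse)
  obtain c2 V V' where 2: "q = (Some (c2, V), Some (c2, V'))"
    "V \<in> sides T (split_link c2)" "V' \<in> sides T (split_link c2)"
    "j \<le> d (part c2 (XX V))" "j \<le> d (part c2 (XX V'))"
    using linked_pairs_newTD[OF kj, of "fst q" "snd q"] q by (metis prod.collapse)
  have "lk W = lk V" "lk W' = lk V'" using pq 1(1) 2(1) by (simp_all add: link_of_def)
  then show "p = q" using eq[OF 1(2,4) 2(2,4)] eq[OF 1(3,5) 2(3,5)] 1(1) 2(1) by simp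
qed

lemma finite_linked_pairs: "finite (linked_pairs G T X j)"
proof -
  have "linked_pairs G T X j \<subseteq> edges T \<times> edges T" by (auto simp: linked_pairs_def)
  then show ?thesis using finite_edges_T by (meson finite_SigmaI finite_subset)
qed

lemma linked_pairs_le:
  assumes "threshold \<le> j"
  shows "card (linked_pairs G newT newX j) \<le> card (linked_pairs G T X j)"
  using card_inj_on_le[OF linked_pairs_inj[OF assms] linked_pairs_image[OF assms] finite_linked_pairs] .

text \<open>If an unstable link \<open>e\<close> attains \<open>threshold\<close>, the pair
  \<open>(e, e)\<close> is lost. Otherwise \<open>threshold = k\<close> and \<open>(a, b)\<close> is
  lost: both originals would need a large piece in the same copy, but that copy splits one of them
  into halves of strictly smaller adhesion.\<close>

lemma linked_pairs_less:
  "card (linked_pairs G newT newX threshold) < card (linked_pairs G T X threshold)"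
proof -
  let ?\<phi> = "map_prod link_of link_of" and ?L = "linked_pairs G newT newX threshold"
  have "\<exists>p \<in> linked_pairs G T X threshold. p \<notin> ?\<phi> ` ?L"
  proof (cases "\<exists>e\<in>edges T. card (adh G T X e) = threshold \<and> \<not> stable e")
    case True
    then obtain e where e: "e \<in> edges T" "card (adh G T X e) = threshold" "\<not> stable e" by blast
    have "between T e e \<subseteq> {e}"
    proof
      fix c assume "c \<in> between T e e"
      then obtain W where W: "edge_cut T W = {c}" "ends T e \<inter> W \<noteq> {}" "\<not> ends T e \<subseteq> W"
        unfolding between_def[OF T] by blast
      have "e \<in> edge_cut T W" using W(2,3) e(1) by (simp add: edge_cut_def)
      then show "c \<in> {e}" using W(1) by simp
    qed
    then have "(e, e) \<in> linked_pairs G T X threshold" using e by (auto simp: linked_pairs_def)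
    moreover have "(e, e) \<notin> ?\<phi> ` ?L"
    proof
      assume "(e, e) \<in> ?\<phi> ` ?L"
      then obtain x y where xy: "(x, y) \<in> ?L" "link_of x = e" by auto
      obtain c W where W: "x = Some (c, W)" "W \<in> sides T (split_link c)" "threshold \<le> d (part c (XX W))"
        using linked_pairs_newTD[OF threshold_ge(1) xy(1)] by metis
      then have "stable e"
        using large_piece_stable[OF W(2) order.refl W(3)] xy(2) unfolding stable_def
        by (auto simp: link_of_def)
      then show False using e(3) by simp
    qed
    ultimately show ?thesis by blast
  next
    case False
    have "threshold \<in> insert k ((\<lambda>e. card (adh G T X e)) ` {e \<in> edges T. k \<le> card (adh G T X e) \<and> \<not> stable e})"
      unfolding threshold_def using finite_edges_T by (intro Max_in) auto
    then have th: "threshold = k" using False by auto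
    have "(a, b) \<in> linked_pairs G T X threshold" using a b large th by (simp add: linked_pairs_def)
    moreover have "(a, b) \<notin> ?\<phi> ` ?L"
    proof
      assume "(a, b) \<in> ?\<phi> ` ?L"
      then obtain x y where xy: "(x, y) \<in> ?L" "link_of x = a" "link_of y = b" by auto
      obtain c W W' where W: "x = Some (c, W)" "y = Some (c, W')"
        "W \<in> sides T (split_link c)" "W' \<in> sides T (split_link c)"
        "threshold \<le> d (part c (XX W))" "threshold \<le> d (part c (XX W'))"
        using linked_pairs_newTD[OF threshold_ge(1) xy(1)] by metis
      have lk: "lk W = a" "lk W' = b" using W xy by (auto simp: link_of_def)
      show False
      proof (cases c)
        case True
        then show False using part_split_less[OF W(4)] edge_cut_lk[OF W(4)] lk
          large_piece_stable[OF W(4) order.refl W(6)] by (simp add: split_link_def)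
      next
        case False
        then show False using part_split_less[OF W(3)] edge_cut_lk[OF W(3)] lk
          large_piece_stable[OF W(3) order.refl W(5)] by (simp add: split_link_def)
      qed
    qed
    ultimately show ?thesis by blast
  qed
  then have "?\<phi> ` ?L \<subset> linked_pairs G T X threshold"
    using linked_pairs_image[OF order.refl] by blast
  then have "card (?\<phi> ` ?L) < card (linked_pairs G T X threshold)"
    using finite_linked_pairs psubset_card_mono by blast
  then show ?thesis using card_image[OF linked_pairs_inj[OF order.refl]] by simp
qed

section \<open>Width of the new decomposition\<close>

lemma adh_le_width: "e \<in> edges T \<Longrightarrow> card (adh G T X e) \<le> decomp_width G T X"
  using decomp_width_le_iff[OF T, of G X "decomp_width G T X"] by simp

text \<open>Ensures that the strict drop happens within the range of levels that
  \<open>fatness\<close> records.\<close>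

lemma threshold_le_width: "threshold \<le> decomp_width G T X"
  unfolding threshold_def using finite_edges_T adh_le_width order.trans[OF k_le_a adh_le_width[OF a]]
  by (subst Max_le_iff) auto

text \<open>\<open>link_of\<close> is injective around such a node, since only one half of the split
  link is attached to a given original node.\<close>

lemma card_bold_links_new:
  "card (bold_links G newT newX (c, Some t)) \<le> card (bold_links G T X t)"
proof (rule card_inj_on_le)
  let ?L = "bold_links G newT newX (c, Some t)"
  have L: "\<exists>W. l = Some (c, W) \<and> W \<in> sides T (split_link c) \<and> t \<in> ends T (lk W) \<and>
    (lk W = split_link c \<longrightarrow> t \<in> W) \<and> bold G newT newX l" if l: "l \<in> ?L" for l
  proof -
    have lE: "l \<in> edges newT" "(c, Some t) \<in> ends newT l" "bold G newT newX l"
      using l by (auto simp: bold_links_def)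
    then obtain c' W where W: "l = Some (c', W)" "W \<in> sides T (split_link c')"
      by (auto simp: newT_edges ends_None)
    obtain x y where xy: "ends T (lk W) = {x, y}" "x \<in> W" "y \<in> verts T - W" 
      "ends newT (Some (c', W)) = {(c', Some x), (c', if lk W = split_link c' then None else Some y)}"
      using ends_SomeE[OF W(2)] .
    then show ?thesis using lE W by (auto split: if_splits)
  qed
  show "inj_on link_of ?L"
  proof (rule inj_onI)
    fix l m assume l: "l \<in> ?L" and m: "m \<in> ?L" and lm: "link_of l = link_of m"
    obtain W where W: "l = Some (c, W)" "W \<in> sides T (split_link c)" "lk W = split_link c \<longrightarrow> t \<in> W"
      using L[OF l] by blast
    obtain V where V: "m = Some (c, V)" "V \<in> sides T (split_link c)" "lk V = split_link c \<longrightarrow> t \<in> V"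
      using L[OF m] by blast
    have lk: "lk W = lk V" using lm W V by (simp add: link_of_def)
    then have cut: "edge_cut T W = edge_cut T V"
      using edge_cut_lk[OF W(2)] edge_cut_lk[OF V(2)] by simp
    have "W = V"
    proof (cases "lk W = split_link c")
      case True
      then show ?thesis using sides_eq_or_compl[OF T W(2) V(2) cut] W(3) V(3) lk by auto
    next
      case False
      then show ?thesis using sides_unique[OF T W(2) V(2) cut _ split_link_edges] edge_cut_lk[OF W(2)]
        by simp
    qed
    then show "l = m" using W V by simp
  qed
  show "link_of ` ?L \<subseteq> bold_links G T X t"
  proof
    fix e assume "e \<in> link_of ` ?L"
    then obtain l where l: "l \<in> ?L" "e = link_of l" by blast
    obtain W where W: "l = Some (c, W)" "W \<in> sides T (split_link c)" "t \<in> ends T (lk W)" "bold G newT newX l"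
      using L[OF l(1)] by blast
    have "bold G T X (lk W)" using W(1,4) adh_new_le[OF W(2)] by (simp add: bold_def)
    then show "e \<in> bold_links G T X t"
      using l(2) W lk_edges[OF W(2)] by (simp add: bold_links_def link_of_def)
  qed
  show "finite (bold_links G T X t)" using finite_edges_T by (simp add: bold_links_def)
qed

text \<open>The subdividing node meets at most three links: the two halves and \<open>None\<close>.
  If one of them is bold, some original link has adhesion at least 3, so the width already allows
  three.\<close>

lemma card_bold_links_new_None:
  "card (bold_links G newT newX (c, None)) \<le> decomp_width G T X"
proof -
  let ?L = "bold_links G newT newX (c, None)" and ?s = "split_link c"
  have "\<exists>V\<in>sides T ?s. edge_cut T V = {?s}"
    by (rule sides_exists[OF T split_link_edges split_link_edges])
  then obtain V where V: "V \<in> sides T ?s" "edge_cut T V = {?s}" by blast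
  have L: "l = None \<or> (\<exists>W. l = Some (c, W) \<and> W \<in> sides T ?s \<and> lk W = ?s)" if l: "l \<in> ?L" for l
  proof (rule ccontr)
    assume n: "\<not> ?thesis"
    have lE: "l \<in> edges newT" "(c, None) \<in> ends newT l" using l by (auto simp: bold_links_def)
    then obtain c' W where W: "l = Some (c', W)" "W \<in> sides T (split_link c')"
      using n by (auto simp: newT_edges)
    obtain x y where "ends newT (Some (c', W)) = {(c', Some x), (c', if lk W = split_link c' then None else Some y)}"
      using ends_SomeE[OF W(2)] by metis
    then show False using lE W n by (auto split: if_splits)
  qed
  have sub: "?L \<subseteq> {None, Some (c, V), Some (c, verts T - V)}"
  proof
    fix l assume "l \<in> ?L"
    from L[OF this] show "l \<in> {None, Some (c, V), Some (c, verts T - V)}"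
    proof
      assume "\<exists>W. l = Some (c, W) \<and> W \<in> sides T ?s \<and> lk W = ?s"
      then obtain W where W: "l = Some (c, W)" "W \<in> sides T ?s" "lk W = ?s" by blast
      then have "edge_cut T W = edge_cut T V" using edge_cut_lk[OF W(2)] V(2) by simp
      then show ?thesis using sides_eq_or_compl[OF T W(2) V(1)] W(1) by auto
    qed simp
  qed
  have c3: "card ?L \<le> 3"
  proof -
    have "card ?L \<le> card {None, Some (c, V), Some (c, verts T - V)}"
      using sub by (intro card_mono) auto
    also have "\<dots> \<le> 3" by (simp add: card_insert_if)
    finally show ?thesis .
  qed
  show ?thesis
  proof (cases "?L = {}")
    case False
    then obtain l where l: "l \<in> ?L" by blast
    have bold: "2 < card (adh G newT newX l)" using l by (simp add: bold_links_def bold_def)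
    have "2 < decomp_width G T X"
      using L[OF l]
    proof
      assume "l = None"
      then have "2 < k" using bold adh_new_None d_U by simp
      then show ?thesis using k_le_a adh_le_width[OF a] by linarith
    next
      assume "\<exists>W. l = Some (c, W) \<and> W \<in> sides T ?s \<and> lk W = ?s"
      then obtain W where W: "l = Some (c, W)" "W \<in> sides T ?s" "lk W = ?s" by blast
      then show ?thesis using bold adh_new_le[OF W(2)] adh_le_width[OF lk_edges[OF W(2)]] by simp
    qed
    then show ?thesis using c3 by linarith
  qed simp
qed

lemma decomp_width_newT: "decomp_width G newT newX \<le> decomp_width G T X"
  unfolding decomp_width_le_iff[OF cut_tree_newT]
proof (intro conjI ballI)
  fix l assume l: "l \<in> edges newT"
  show "card (adh G newT newX l) \<le> decomp_width G T X"
  proof (cases "l = None")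
    case True
    then show ?thesis using adh_new_None d_U k_le_a adh_le_width[OF a] by simp
  next
    case False
    then obtain c W where W: "l = Some (c, W)" "W \<in> sides T (split_link c)"
      using l by (auto simp: newT_edges)
    then show ?thesis using adh_new_le[OF W(2)] adh_le_width[OF lk_edges[OF W(2)]] by simp
  qed
next
  fix p assume p: "p \<in> verts newT"
  obtain c n where cn: "p = (c, n)" by (cases p)
  show "card (newX p) + card (bold_links G newT newX p) \<le> decomp_width G T X"
  proof (cases n)
    case None
    then show ?thesis using card_bold_links_new_None[of c] cn by (simp add: newX_def)
  next
    case (Some t)
    then have t: "t \<in> verts T" using p cn by (simp add: newT_verts)
    have "finite (X t)" using X(2) t G by (auto simp: fin_multigraph_def intro: finite_subset)
    moreover have "newX p \<subseteq> X t" using cn Some by (auto simp: newX_def part_def)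
    ultimately have "card (newX p) \<le> card (X t)" by (rule card_mono)
    moreover have "card (bold_links G newT newX p) \<le> card (bold_links G T X t)"
      using card_bold_links_new[of c t] cn Some by simp
    moreover have "card (X t) + card (bold_links G T X t) \<le> decomp_width G T X"
      using decomp_width_le_iff[OF T, of G X "decomp_width G T X"] t by simp
    ultimately show ?thesis by linarith
  qed
qed

end


section \<open>Relabelling and the minimal decomposition\<close>

lemma between_subset: "cut_tree T \<Longrightarrow> between T e h \<subseteq> edges T"
  using between_def by (fastforce simp: edge_cut_def)

text \<open>The new tree has other node and link types than \<open>T\<close>, whereas minimality
  ranges over trees on natural numbers; relabelling brings it back.\<close>

definition relabel :: "('t \<Rightarrow> 's) \<Rightarrow> ('l \<Rightarrow> 'm) \<Rightarrow> ('t, 'l) mgraph \<Rightarrow> ('s, 'm) mgraph" where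
  "relabel f g T = \<lparr>verts = f ` verts T, edges = g ` edges T,
     ends = (\<lambda>m. f ` ends T (inv_into (edges T) g m))\<rparr>"

context
  fixes G :: "('v, 'e) mgraph" and T :: "('t, 'l) mgraph" and X :: "'t \<Rightarrow> 'v set"
    and f :: "'t \<Rightarrow> 's" and g :: "'l \<Rightarrow> 'm"
  assumes T: "cut_tree T" and G: "fin_multigraph G"
    and X: "disjoint_family_on X (verts T)" "(\<Union>t\<in>verts T. X t) = verts G"
    and f: "inj_on f (verts T)" and g: "inj_on g (edges T)"
begin

abbreviation (input) "T' \<equiv> relabel f g T"
abbreviation (input) "X' \<equiv> X \<circ> inv_into (verts T) f"

lemma relabel_ends: "l \<in> edges T \<Longrightarrow> ends T' (g l) = f ` ends T l"
  using g by (simp add: relabel_def)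

lemma relabel_ends_subset: "l \<in> edges T \<Longrightarrow> ends T l \<subseteq> verts T"
  using fin_multigraph_ends(1)[OF cut_tree_fin[OF T]] .

lemma relabel_inter_empty_iff: "Y \<subseteq> verts T \<Longrightarrow> W \<subseteq> verts T \<Longrightarrow> f ` Y \<inter> f ` W = {} \<longleftrightarrow> Y \<inter> W = {}"
  by (subst inj_on_image_Int[OF f, symmetric]) auto

lemma relabel_subset_iff: "Y \<subseteq> verts T \<Longrightarrow> W \<subseteq> verts T \<Longrightarrow> f ` Y \<subseteq> f ` W \<longleftrightarrow> Y \<subseteq> W"
  using inj_onD[OF f] by blast

lemma relabel_cut:
  assumes W: "W \<subseteq> verts T"
  shows "edge_cut T' (f ` W) = g ` edge_cut T W"
proof -
  have "g l \<in> edge_cut T' (f ` W) \<longleftrightarrow> l \<in> edge_cut T W" if l: "l \<in> edges T" for l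
    using l relabel_inter_empty_iff[OF relabel_ends_subset[OF l] W]
      relabel_subset_iff[OF relabel_ends_subset[OF l] W]
    unfolding edge_cut_def mem_Collect_eq relabel_ends[OF l] by (simp add: relabel_def)
  moreover have "edge_cut T' (f ` W) \<subseteq> g ` edges T" "edge_cut T W \<subseteq> edges T"
    by (auto simp: edge_cut_def relabel_def)
  ultimately show ?thesis by blast
qed

lemma relabel_subsetE:
  assumes "W' \<subseteq> verts T'"
  obtains W where "W \<subseteq> verts T" "W' = f ` W"
  using assms by (auto simp: relabel_def subset_image_iff)

lemma relabel_edge: "l \<in> edges T \<Longrightarrow> g l \<in> edges T'"
  by (simp add: relabel_def)

lemma cut_tree_relabel: "cut_tree T'"
  unfolding cut_tree_def
proof (intro conjI allI impI ballI)
  have T1: "fin_multigraph T" using cut_tree_fin[OF T] .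
  show "fin_multigraph T'"
    unfolding fin_multigraph_def
  proof (intro conjI ballI)
    show "finite (verts T')" "finite (edges T')"
      using T1 by (auto simp: relabel_def fin_multigraph_def)
    fix m assume "m \<in> edges T'"
    then obtain l where l: "l \<in> edges T" "m = g l" by (auto simp: relabel_def)
    show "ends T' m \<subseteq> verts T'"
      using relabel_ends_subset[OF l(1)] l relabel_ends by (auto simp: relabel_def)
    have "card (f ` ends T l) = card (ends T l)"
      using inj_on_subset[OF f relabel_ends_subset[OF l(1)]] by (rule card_image)
    then show "card (ends T' m) = 2"
      using fin_multigraph_ends(2)[OF T1 l(1)] relabel_ends[OF l(1)] l(2) by simp
  qed
  show "verts T' \<noteq> {}" using T by (simp add: cut_tree_def relabel_def)
  fix W' assume W': "W' \<subseteq> verts T'" "edge_cut T' W' = {}"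
  obtain W where W: "W \<subseteq> verts T" "W' = f ` W" using relabel_subsetE[OF W'(1)] .
  then have "edge_cut T W = {}" using relabel_cut[OF W(1)] W'(2) by simp
  then have "W = {} \<or> W = verts T" using cut_tree_trivial[OF T W(1)] by blast
  then show "W' = {} \<or> W' = verts T'" using W by (auto simp: relabel_def)
next
  fix m assume "m \<in> edges T'"
  then obtain l where l: "l \<in> edges T" "m = g l" by (auto simp: relabel_def)
  have "\<exists>W\<subseteq>verts T. edge_cut T W = {l}" using T l(1) by (simp add: cut_tree_def)
  then obtain W where W: "W \<subseteq> verts T" "edge_cut T W = {l}" by blast
  then have "edge_cut T' (f ` W) = {m}" "f ` W \<subseteq> verts T'"
    using relabel_cut l by (auto simp: relabel_def)
  then show "\<exists>W\<subseteq>verts T'. edge_cut T' W = {m}" by blast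
qed

lemma relabel_bag: "t \<in> verts T \<Longrightarrow> X' (f t) = X t"
  using f by simp

lemma relabel_bags: "W \<subseteq> verts T \<Longrightarrow> (\<Union>s\<in>f ` W. X' s) = (\<Union>t\<in>W. X t)"
  using relabel_bag by fastforce

lemma relabel_disjoint: "disjoint_family_on X' (verts T')"
  using X(1) relabel_bag by (fastforce simp: disjoint_family_on_def relabel_def)

lemma relabel_union: "(\<Union>s\<in>verts T'. X' s) = verts G"
  using relabel_bags[of "verts T"] X(2) by (simp add: relabel_def)

lemma relabel_adh:
  assumes l: "l \<in> edges T"
  shows "adh G T' X' (g l) = adh G T X l"
proof -
  have "\<exists>W\<subseteq>verts T. edge_cut T W = {l}" using T l by (simp add: cut_tree_def)
  then obtain W where W: "W \<subseteq> verts T" "edge_cut T W = {l}" by blast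
  then have W': "edge_cut T' (f ` W) = {g l}" "f ` W \<subseteq> verts T'"
    using relabel_cut by (auto simp: relabel_def)
  show ?thesis
    using adh_eq_cut[OF T X G W] adh_eq_cut[OF cut_tree_relabel relabel_disjoint relabel_union G W'(2,1)]
      relabel_bags[OF W(1)] by (simp only:)
qed

lemma relabel_between:
  assumes "e \<in> edges T" "h \<in> edges T"
  shows "between T' (g e) (g h) = g ` between T e h"
proof (intro equalityI subsetI)
  fix m assume "m \<in> between T' (g e) (g h)"
  then obtain W' where W': "W' \<subseteq> verts T'" "edge_cut T' W' = {m}"
    "f ` ends T e \<inter> W' \<noteq> {}" "\<not> f ` ends T h \<subseteq> W'"
    unfolding between_def[OF cut_tree_relabel] relabel_ends[OF assms(1)] relabel_ends[OF assms(2)]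
    by blast
  obtain W where W: "W \<subseteq> verts T" "W' = f ` W" using relabel_subsetE[OF W'(1)] .
  have img: "g ` edge_cut T W = {m}" using relabel_cut[OF W(1)] W W' by simp
  have sub: "edge_cut T W \<subseteq> edges T" by (auto simp: edge_cut_def)
  have "m \<in> g ` edge_cut T W" using img by blast
  then obtain l where "l \<in> edge_cut T W" and ml: "m = g l" by blast
  moreover have "l' = l" if "l' \<in> edge_cut T W" for l'
  proof -
    have "g l' = g l" using img that ml by blast
    then show ?thesis using sub that \<open>l \<in> edge_cut T W\<close> inj_onD[OF g] by blast
  qed
  ultimately have l: "edge_cut T W = {l}" "m = g l" by blast+
  have "ends T e \<inter> W \<noteq> {}" "\<not> ends T h \<subseteq> W"
    using W'(3,4) relabel_inter_empty_iff[OF relabel_ends_subset W(1)]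
      relabel_subset_iff[OF relabel_ends_subset W(1)] assms W(2) by auto
  then have "l \<in> between T e h" using W(1) l(1) unfolding between_def[OF T] by blast
  then show "m \<in> g ` between T e h" using l(2) by blast
next
  fix m assume "m \<in> g ` between T e h"
  then obtain l W where l: "m = g l" "W \<subseteq> verts T" "edge_cut T W = {l}" "ends T e \<inter> W \<noteq> {}" "\<not> ends T h \<subseteq> W"
    unfolding between_def[OF T] by blast
  have "f ` W \<subseteq> verts T'" "edge_cut T' (f ` W) = {m}"
    using l relabel_cut[OF l(2)] by (auto simp: relabel_def)
  moreover have "ends T' (g e) \<inter> f ` W \<noteq> {}"
    using relabel_inter_empty_iff[OF relabel_ends_subset[OF assms(1)] l(2)] l(4) relabel_ends[OF assms(1)]
    by simp
  moreover have "\<not> ends T' (g h) \<subseteq> f ` W"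
    using relabel_subset_iff[OF relabel_ends_subset[OF assms(2)] l(2)] l(5) relabel_ends[OF assms(2)]
    by simp
  ultimately show "m \<in> between T' (g e) (g h)" unfolding between_def[OF cut_tree_relabel] by blast
qed

lemma card_linked_pairs_relabel: "card (linked_pairs G T' X' j) = card (linked_pairs G T X j)"
proof -
  have mem: "(g e, g h) \<in> linked_pairs G T' X' j \<longleftrightarrow> (e, h) \<in> linked_pairs G T X j"
    if "e \<in> edges T" "h \<in> edges T" for e h
  proof -
    have "\<forall>c\<in>between T e h. adh G T' X' (g c) = adh G T X c"
      using between_subset[OF T, of e h] relabel_adh by blast
    then show ?thesis
      using that relabel_between[OF that] relabel_edge by (simp add: linked_pairs_def)
  qed
  have "linked_pairs G T' X' j = map_prod g g ` linked_pairs G T X j"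
  proof (intro equalityI subsetI)
    fix p assume p: "p \<in> linked_pairs G T' X' j"
    then have "fst p \<in> g ` edges T" "snd p \<in> g ` edges T"
      by (auto simp: linked_pairs_def relabel_def)
    then obtain e h where eh: "e \<in> edges T" "h \<in> edges T" "p = (g e, g h)"
      by (metis imageE prod.collapse)
    then show "p \<in> map_prod g g ` linked_pairs G T X j" using p mem by force
  next
    fix p assume "p \<in> map_prod g g ` linked_pairs G T X j"
    then obtain e h where eh: "(e, h) \<in> linked_pairs G T X j" "p = (g e, g h)" by auto
    then have "e \<in> edges T" "h \<in> edges T" by (auto simp: linked_pairs_def)
    then show "p \<in> linked_pairs G T' X' j" using eh mem by simp
  qed
  moreover have "inj_on (map_prod g g) (linked_pairs G T X j)"
    by (rule inj_on_subset[OF map_prod_inj_on[OF g g]]) (auto simp: linked_pairs_def)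
  ultimately show ?thesis by (simp add: card_image)
qed

lemma decomp_width_relabel: "decomp_width G T' X' = decomp_width G T X"
proof -
  have bold: "card (bold_links G T' X' (f t)) = card (bold_links G T X t)" if t: "t \<in> verts T" for t
  proof -
    have "g l \<in> bold_links G T' X' (f t) \<longleftrightarrow> l \<in> bold_links G T X t" if l: "l \<in> edges T" for l
      using l relabel_ends[OF l] relabel_adh[OF l] relabel_edge[OF l]
        inj_on_image_mem_iff[OF f t relabel_ends_subset[OF l]]
      by (simp add: bold_links_def bold_def)
    moreover have "bold_links G T' X' (f t) \<subseteq> g ` edges T" "bold_links G T X t \<subseteq> edges T"
      by (auto simp: bold_links_def relabel_def)
    ultimately have "bold_links G T' X' (f t) = g ` bold_links G T X t" by blast
    moreover have "inj_on g (bold_links G T X t)"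
      using inj_on_subset[OF g] by (auto simp: bold_links_def)
    ultimately show ?thesis by (simp add: card_image)
  qed
  have "decomp_width G T' X' \<le> w \<longleftrightarrow> decomp_width G T X \<le> w" for w
    unfolding decomp_width_le_iff[OF T] decomp_width_le_iff[OF cut_tree_relabel]
    using relabel_adh bold relabel_bag by (simp add: relabel_def)
  then show ?thesis by (meson order.antisym order.refl)
qed

end

lemma tree_cut_decomp_iff:
  "tree_cut_decomp G T X \<longleftrightarrow> cut_tree T \<and> disjoint_family_on X (verts T) \<and> (\<Union>t\<in>verts T. X t) = verts G"
  by (simp add: tree_cut_decomp_def is_tree_iff_cut_tree)

lemma nat_relabel:
  fixes T :: "('t, 'l) mgraph"
  assumes G: "fin_multigraph G" and T: "tree_cut_decomp G T X"
  obtains S :: "(nat, nat) mgraph" and Y where "tree_cut_decomp G S Y"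
    "decomp_width G S Y = decomp_width G T X"
    "\<And>j. card (linked_pairs G S Y j) = card (linked_pairs G T X j)"
proof -
  have T': "cut_tree T" "disjoint_family_on X (verts T)" "(\<Union>t\<in>verts T. X t) = verts G"
    using T by (auto simp: tree_cut_decomp_iff)
  have "finite (verts T)" "finite (edges T)"
    using T'(1) by (auto simp: cut_tree_def fin_multigraph_def)
  then obtain f :: "'t \<Rightarrow> nat" and g :: "'l \<Rightarrow> nat" where fg: "inj_on f (verts T)" "inj_on g (edges T)"
    using finite_imp_inj_to_nat_seg by metis
  show ?thesis
  proof
    show "tree_cut_decomp G (relabel f g T) (X \<circ> inv_into (verts T) f)"
      unfolding tree_cut_decomp_iff
      using cut_tree_relabel[OF T'(1) G T'(2,3) fg] relabel_disjoint[OF T'(1) G T'(2,3) fg]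
        relabel_union[OF T'(1) G T'(2,3) fg]
      by blast
    show "decomp_width G (relabel f g T) (X \<circ> inv_into (verts T) f) = decomp_width G T X"
      using decomp_width_relabel[OF T'(1) G T'(2,3) fg] .
    show "\<And>j. card (linked_pairs G (relabel f g T) (X \<circ> inv_into (verts T) f) j) = card (linked_pairs G T X j)"
      using card_linked_pairs_relabel[OF T'(1) G T'(2,3) fg] .
  qed
qed

text \<open>The order on multisets of natural numbers compares multiplicities lexicographically,
  starting with the largest element.\<close>

definition fatness :: "('v, 'e) mgraph \<Rightarrow> ('t, 'l) mgraph \<Rightarrow> ('t \<Rightarrow> 'v set) \<Rightarrow> nat \<Rightarrow> nat multiset" where
  "fatness G T X w = (\<Sum>j\<le>w. replicate_mset (card (linked_pairs G T X j)) j)"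

lemma count_fatness: "count (fatness G T X w) j = (if j \<le> w then card (linked_pairs G T X j) else 0)"
  by (auto simp: fatness_def count_sum)

lemma not_lean_violation:
  assumes G: "fin_multigraph G" and T: "tree_cut_decomp G T X" and not_lean: "\<not> lean G T X"
  obtains a b k A B U where "violation G T X a b k A B U"
proof -
  have T': "cut_tree T" "disjoint_family_on X (verts T)" "(\<Union>t\<in>verts T. X t) = verts G"
    using T by (auto simp: tree_cut_decomp_iff)
  obtain k a b A B where ab: "a \<in> edges T" "b \<in> edges T" and AB: "A \<subseteq> adh G T X a" "B \<subseteq> adh G T X b" "card A = k" "card B = k"
    and no: "\<not> edge_disjoint_linkage G A B k"
    and large: "\<And>c. c \<in> edges T \<Longrightarrow> on_link_path T a b c \<Longrightarrow> \<not> card (adh G T X c) < k"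
    using not_lean unfolding lean_def by blast
  have "A \<subseteq> edges G" "B \<subseteq> edges G" using AB by (auto simp: adh_def)
  then obtain U0 where U0: "U0 \<subseteq> verts G" "card (sepset G A B U0) < k"
    using no_linkage_sepset[OF G _ _ no] by blast
  let ?s = "\<lambda>U. card (sepset G A B U)" and ?c = "\<lambda>U. card (crossed T X a b U)"
  obtain U1 where U1: "U1 \<subseteq> verts G" "\<And>U. U \<subseteq> verts G \<Longrightarrow> ?s U1 \<le> ?s U"
    using ex_has_least_nat[of "\<lambda>U. U \<subseteq> verts G" U0 ?s] U0(1) by blast
  obtain U where U: "U \<subseteq> verts G" "?s U \<le> ?s U1"
    "\<And>V. V \<subseteq> verts G \<and> ?s V \<le> ?s U1 \<Longrightarrow> ?c U \<le> ?c V"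
    using ex_has_least_nat[of "\<lambda>U. U \<subseteq> verts G \<and> ?s U \<le> ?s U1" U1 ?c] U1(1) by blast
  have "violation G T X a b k A B U"
  proof
    show "?s U < k" using U(2) U1(2)[OF U0(1)] U0(2) by linarith
    show "\<And>V. V \<subseteq> verts G \<Longrightarrow> ?s U \<le> ?s V" using U(2) U1(2) order.trans by blast
    show "\<And>V. V \<subseteq> verts G \<Longrightarrow> ?s V \<le> ?s U \<Longrightarrow> ?c U \<le> ?c V" using U(2,3) order.trans by blast
    show "k \<le> card (adh G T X c)" if "c \<in> between T a b" for c
      using large[of c] between_on_link_path[OF T'(1) ab that] between_subset[OF T'(1)] that
      by (meson linorder_not_less subsetD)
  qed (use G T' ab AB U in auto)
  then show ?thesis using that by blast
qed

text \<open>Both multisets are truncated at the old width, so they are comparable even if the width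
  drops; for a decomposition of minimum width the two widths agree.\<close>

lemma violation_improve:
  fixes T :: "('t, 'l) mgraph"
  assumes V: "violation G T X a b k A B U"
  obtains S :: "(nat, nat) mgraph" and Y where "tree_cut_decomp G S Y"
    "decomp_width G S Y \<le> decomp_width G T X"
    "fatness G S Y (decomp_width G T X) < fatness G T X (decomp_width G T X)"
proof -
  interpret violation G T X a b k A B U by (rule V)
  let ?w = "decomp_width G T X"
  have "tree_cut_decomp G newT newX"
    using cut_tree_newT newX_disjoint newX_verts by (simp add: tree_cut_decomp_iff)
  then obtain S :: "(nat, nat) mgraph" and Y where S: "tree_cut_decomp G S Y"
    "decomp_width G S Y = decomp_width G newT newX"
    "\<And>j. card (linked_pairs G S Y j) = card (linked_pairs G newT newX j)"
    using nat_relabel[OF G] by metis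
  have le: "count (fatness G S Y ?w) j \<le> count (fatness G T X ?w) j" if "threshold \<le> j" for j
    using linked_pairs_le[OF that] by (simp add: count_fatness S(3))
  have less: "count (fatness G S Y ?w) threshold < count (fatness G T X ?w) threshold"
    using linked_pairs_less threshold_le_width by (simp add: count_fatness S(3))
  have "fatness G S Y ?w < fatness G T X ?w"
    unfolding less_multiset\<^sub>H\<^sub>O
  proof (intro conjI allI impI)
    show "fatness G S Y ?w \<noteq> fatness G T X ?w" using less by auto
    fix y assume "count (fatness G T X ?w) y < count (fatness G S Y ?w) y"
    \<comment> \<open>A level at which the new count is larger lies below \<open>threshold\<close>,
      where the new count is strictly smaller; this is the criterion for the multiset order.\<close>
    then have "y < threshold" using le[of y] by (meson leD linorder_le_less_linear)
    then show "\<exists>x>y. count (fatness G S Y ?w) x < count (fatness G T X ?w) x" using less by blast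
  qed
  then show ?thesis using that S decomp_width_newT by simp
qed

lemma trivial_decomp:
  "\<exists>(T :: (nat, nat) mgraph) X. tree_cut_decomp G T X"
proof -
  define T :: "(nat, nat) mgraph" where "T = \<lparr>verts = {0}, edges = {}, ends = \<lambda>_. {}\<rparr>"
  have "cut_tree T" by (auto simp: T_def cut_tree_def fin_multigraph_def)
  then have "tree_cut_decomp G T (\<lambda>_. verts G)"
    unfolding tree_cut_decomp_iff by (simp add: T_def disjoint_family_on_def)
  then show ?thesis by blast
qed

theorem theorem1p3:
  fixes G :: "('v, 'e) mgraph"
  assumes "fin_multigraph G"
  shows "\<exists>(T :: (nat, nat) mgraph) X.
    tree_cut_decomp G T X \<and> decomp_width G T X = tcw G \<and> lean G T X"
proof -
  let ?P = "\<lambda>w. \<exists>(T :: (nat, nat) mgraph) X. tree_cut_decomp G T X \<and> decomp_width G T X = w"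
  have "\<exists>w. ?P w" using trivial_decomp[of G] by blast
  then have ex: "?P (tcw G)" unfolding tcw_def by (rule LeastI_ex)
  have least: "tcw G \<le> decomp_width G T X" if "tree_cut_decomp G T X" for T :: "(nat, nat) mgraph" and X
    unfolding tcw_def using that by (intro Least_le) blast
  let ?M = "{fatness G T X (tcw G) | (T :: (nat, nat) mgraph) X.
    tree_cut_decomp G T X \<and> decomp_width G T X = tcw G}"
  have "\<exists>m. m \<in> ?M" using ex by blast
  \<comment> \<open>Finite multisets over a well-order are well-ordered, so a least fatness
    exists.\<close>
  then obtain m where m: "m \<in> ?M" "\<And>m'. m' < m \<Longrightarrow> m' \<notin> ?M"
    using exists_least_iff[of "\<lambda>m. m \<in> ?M"] by blast
  then obtain T :: "(nat, nat) mgraph" and X where T: "m = fatness G T X (tcw G)"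
    "tree_cut_decomp G T X" "decomp_width G T X = tcw G" by blast
  have "lean G T X"
  proof (rule ccontr)
    assume "\<not> lean G T X"
    then obtain a b k A B U where "violation G T X a b k A B U"
      by (rule not_lean_violation[OF assms T(2)])
    then obtain S :: "(nat, nat) mgraph" and Y where S: "tree_cut_decomp G S Y"
      "decomp_width G S Y \<le> decomp_width G T X"
      "fatness G S Y (decomp_width G T X) < fatness G T X (decomp_width G T X)"
      by (rule violation_improve)
    then have "decomp_width G S Y = tcw G" using least[OF S(1)] T(3) by simp
    then show False using m(2)[of "fatness G S Y (tcw G)"] S T by auto
  qed
  then show ?thesis using T by blast
qed

end
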